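(* Suppose the digraph $\mathcal{G}$ is strongly connected, and let the weights $a_{ij},b_{ih}$ be as in the context. Let $M_0=\begin{bmatrix} I-L & 0\\ L & S\end{bmatrix}$. Let $r$ be the largest modulus among the eigenvalues of $M_0$ that remain after two copies of the eigenvalue $1$ are removed from its spectrum (eigenvalues counted with algebraic multiplicity). Set $$\bar\epsilon^{(d)}=\frac{(1-r)^n}{(20+8n)^n}.$$ Then for every $\epsilon\in(0,\bar\epsilon^{(d)})$, the deterministic algorithm with parameter $\epsilon$ achieves average consensus.
   Context: Setting: $\mathcal{G}=(\mathcal{V},\mathcal{E})$ is a digraph with $\mathcal{V}=\{1,\dots,n\}$, $n>1$, and no selfloops. An edge $(j,i)$ means that $j$ sends to $i$. Write $\mathcal{N}_i^+=\{j:(j,i)\in\mathcal{E}\}$ and $\mathcal{N}_i^-=\{h:(i,h)\in\mathcal{E}\}$. Weights: $a_{ij}\in(0,1)$ if $j\in\mathcal{N}_i^+$, $a_{ij}=0$ otherwise, and $\sum_j a_{ij}<1$. Also $b_{ih}\in(0,1)$ if $h\in\mathcal{N}_i^-$, $b_{ih}=0$ otherwise, and $\sum_h b_{ih}<1$. Matrices: $L=D-A$, where $A=[a_{ij}]$ and $D=\mathrm{diag}(\sum_j a_{ij})$. $S=(I-\tilde D)+B$, where $B=[b_{ih}]^T$ and $\tilde D=\mathrm{diag}(\sum_h b_{ih})$. For $\epsilon>0$, $M=\begin{bmatrix} I-L & \epsilon I\\ L & S-\epsilon I\end{bmatrix}$. Deterministic algorithm: $(x(k+1),s(k+1))^T=M(x(k),s(k))^T$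 with $x(k),s(k)\in\mathbb{R}^n$ and $s(0)=0$. Average consensus: the algorithm achieves it if for every $x(0)$ we have $(x(k),s(k))\to(x_a\mathbf{1},0)$, where $x_a=\mathbf{1}^Tx(0)/n$. *)

theory Defs
  imports Complex_Main "Jordan_Normal_Form.Char_Poly"
begin

text \<open>Vertices are 0,...,n-1 (shifted from 1,...,n). E is the edge set: (j,i) \<in> E means j sends to i.\<close>

definition digraph_on :: "nat \<Rightarrow> (nat \<times> nat) set \<Rightarrow> bool" where
  "digraph_on n E \<longleftrightarrow> E \<subseteq> {..<n} \<times> {..<n} \<and> (\<forall>i. (i, i) \<notin> E)"

definition strongly_connected :: "nat \<Rightarrow> (nat \<times> nat) set \<Rightarrow> bool" where
  "strongly_connected n E \<longleftrightarrow> (\<forall>i<n. \<forall>j<n. (i, j) \<in> E\<^sup>*)"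

text \<open>a i j in (0,1) iff j is an in-neighbour of i, i.e. (j,i) in E; row sums < 1.\<close>
definition valid_a :: "nat \<Rightarrow> (nat \<times> nat) set \<Rightarrow> (nat \<Rightarrow> nat \<Rightarrow> real) \<Rightarrow> bool" where
  "valid_a n E a \<longleftrightarrow>
     (\<forall>i<n. \<forall>j<n. ((j, i) \<in> E \<longrightarrow> 0 < a i j \<and> a i j < 1) \<and> ((j, i) \<notin> E \<longrightarrow> a i j = 0))
     \<and> (\<forall>i<n. (\<Sum>j<n. a i j) < 1)"

text \<open>b i h in (0,1) iff h is an out-neighbour of i, i.e. (i,h) in E; row sums < 1.\<close>
definition valid_b :: "nat \<Rightarrow> (nat \<times> nat) set \<Rightarrow> (nat \<Rightarrow> nat \<Rightarrow> real) \<Rightarrow> bool" where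
  "valid_b n E b \<longleftrightarrow>
     (\<forall>i<n. \<forall>h<n. ((i, h) \<in> E \<longrightarrow> 0 < b i h \<and> b i h < 1) \<and> ((i, h) \<notin> E \<longrightarrow> b i h = 0))
     \<and> (\<forall>i<n. (\<Sum>h<n. b i h) < 1)"

definition A_mat :: "nat \<Rightarrow> (nat \<Rightarrow> nat \<Rightarrow> real) \<Rightarrow> real mat" where
  "A_mat n a = mat n n (\<lambda>(i, j). a i j)"

definition D_mat :: "nat \<Rightarrow> (nat \<Rightarrow> nat \<Rightarrow> real) \<Rightarrow> real mat" where
  "D_mat n a = mat n n (\<lambda>(i, j). if i = j then (\<Sum>k<n. a i k) else 0)"

definition L_mat :: "nat \<Rightarrow> (nat \<Rightarrow> nat \<Rightarrow> real) \<Rightarrow> real mat" where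
  "L_mat n a = D_mat n a - A_mat n a"

text \<open>B = [b_ih]^T, tilde D = diag of row sums of b, S = (I - tilde D) + B.\<close>
definition B_mat :: "nat \<Rightarrow> (nat \<Rightarrow> nat \<Rightarrow> real) \<Rightarrow> real mat" where
  "B_mat n b = transpose_mat (mat n n (\<lambda>(i, h). b i h))"

definition S_mat :: "nat \<Rightarrow> (nat \<Rightarrow> nat \<Rightarrow> real) \<Rightarrow> real mat" where
  "S_mat n b = (1\<^sub>m n - D_mat n b) + B_mat n b"

definition M_mat :: "nat \<Rightarrow> (nat \<Rightarrow> nat \<Rightarrow> real) \<Rightarrow> (nat \<Rightarrow> nat \<Rightarrow> real) \<Rightarrow> real \<Rightarrow> real mat" where
  "M_mat n a b \<epsilon> = four_block_mat (1\<^sub>m n - L_mat n a) (\<epsilon> \<cdot>\<^sub>m 1\<^sub>m n)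
                                   (L_mat n a) (S_mat n b - \<epsilon> \<cdot>\<^sub>m 1\<^sub>m n)"

text \<open>M_0 = M with epsilon = 0.\<close>
definition M0_mat :: "nat \<Rightarrow> (nat \<Rightarrow> nat \<Rightarrow> real) \<Rightarrow> (nat \<Rightarrow> nat \<Rightarrow> real) \<Rightarrow> real mat" where
  "M0_mat n a b = four_block_mat (1\<^sub>m n - L_mat n a) (0\<^sub>m n n) (L_mat n a) (S_mat n b)"

text \<open>Largest modulus of the eigenvalues (with algebraic multiplicity, i.e. roots of the
  characteristic polynomial over C) after removing two copies of the eigenvalue 1.\<close>
definition r_rem :: "real mat \<Rightarrow> real" where
  "r_rem M = (let p = char_poly (map_mat complex_of_real M) in
     Max ({cmod z | z. poly p z = 0 \<and> z \<noteq> 1} \<union> (if order 1 p \<ge> 3 then {1} else {})))"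

text \<open>State of the deterministic algorithm: (x(k), s(k)) = M^k (x(0), 0).\<close>
definition traj :: "nat \<Rightarrow> real mat \<Rightarrow> (nat \<Rightarrow> real) \<Rightarrow> nat \<Rightarrow> real vec" where
  "traj n M x0 k = (M ^\<^sub>m k) *\<^sub>v vec (2 * n) (\<lambda>i. if i < n then x0 i else 0)"

definition average_consensus :: "nat \<Rightarrow> real mat \<Rightarrow> bool" where
  "average_consensus n M \<longleftrightarrow>
     (\<forall>x0 :: nat \<Rightarrow> real. \<forall>i < 2 * n.
        (\<lambda>k. traj n M x0 k $ i) \<longlonglongrightarrow>
          (if i < n then (\<Sum>j<n. x0 j) / real n else 0))"

end

theory Submission
  imports Defs "Jordan_Normal_Form.Spectral_Radius"
begin

text \<open>
  Write \<open>P = I - L\<close> (row stochastic, stationary vector \<open>\<pi>\<close>) and let \<open>\<sigma>\<close> be the stationary vector of the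
  column stochastic \<open>S\<close>. The spectrum of \<open>M\<^sub>0\<close> is that of \<open>P\<close> together with that of \<open>S\<close>.

  Since \<open>P\<close> is a contraction in the sup norm and \<open>S\<close> in the 1-norm, their resolvents outside the
  unit disc, restricted to the complement of the eigenvalue 1, are bounded by a constant \<open>q\<close> of order
  \<open>3\<^sup>n / (1 - r)\<close>, linear in \<open>1 / (1 - r)\<close>. A bound of order \<open>1 / (1 - r) ^ (n - 1)\<close>, as the adjugate
  would give, is too weak: the argument multiplies two resolvents, and \<open>\<epsilon>\<close> is only known to be below a multiple of \<open>(1 - r)\<^sup>n\<close>.

  Suppose \<open>(x, s)\<close> is an eigenvector of \<open>M\<close> with entries summing to 0 and eigenvalue \<open>1 + \<mu>\<close> of modulus at
  least 1. Splitting \<open>x\<close> along \<open>1\<close> and \<open>s\<close> along \<open>\<sigma>\<close>, the resolvent bounds give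
  \<open>\<mu> X = - n \<epsilon> (\<pi> \<bullet> \<sigma>)\<close> with \<open>X\<close> close to 1, which forces \<open>|1 + \<mu>| < 1\<close>. The factor \<open>\<pi> \<bullet> \<sigma>\<close>, positive by
  strong connectivity but arbitrarily small, comes out exactly, so the error terms need not be compared
  with it. Hence 1 is the only eigenvalue of \<open>M\<close> outside the open unit disc, and it is simple.
\<close>

section \<open>Polynomials in an operator and the Cayley--Hamilton theorem\<close>

text \<open>Vectors are total functions on \<open>nat\<close>, so that powers and polynomials of an
  operator carry no dimension side conditions; the dimension enters through \<open>mat_op\<close>,
  which returns 0 from index \<open>n\<close> on.\<close>

definition lin_op :: "((nat \<Rightarrow> complex) \<Rightarrow> nat \<Rightarrow> complex) \<Rightarrow> bool" where
  "lin_op T \<longleftrightarrow> (\<forall>x y. T (\<lambda>i. x i + y i) = (\<lambda>i. T x i + T y i))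
     \<and> (\<forall>c x. T (\<lambda>i. c * x i) = (\<lambda>i. c * T x i))"

definition seminorm :: "((nat \<Rightarrow> complex) \<Rightarrow> real) \<Rightarrow> bool" where
  "seminorm \<nu> \<longleftrightarrow> (\<forall>x y. \<nu> (\<lambda>i. x i + y i) \<le> \<nu> x + \<nu> y)
     \<and> (\<forall>c x. \<nu> (\<lambda>i. c * x i) = cmod c * \<nu> x)"

lemma lin_opD:
  assumes "lin_op T"
  shows "T (\<lambda>i. x i + y i) = (\<lambda>i. T x i + T y i)" "T (\<lambda>i. c * x i) = (\<lambda>i. c * T x i)"
  using assms by (auto simp: lin_op_def)

lemma lin_op_zero: "lin_op T \<Longrightarrow> T (\<lambda>i. 0) = (\<lambda>i. 0)"
  using lin_opD(2)[of T 0 "\<lambda>i. 0"] by simp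

lemma lin_op_comb:
  assumes "lin_op T"
  shows "T (\<lambda>i. a * x i + b * y i) = (\<lambda>i. a * T x i + b * T y i)"
  using lin_opD[OF assms] by simp

lemma lin_op_diff:
  assumes "lin_op T"
  shows "T (\<lambda>i. c * x i - y i) = (\<lambda>i. c * T x i - T y i)"
  using lin_op_comb[OF assms, of c x "-1" y] by simp

lemma lin_op_sum:
  assumes "lin_op T"
  shows "T (\<lambda>i. \<Sum>l\<in>A. f l i) = (\<lambda>i. \<Sum>l\<in>A. T (f l) i)"
proof (induction A rule: infinite_finite_induct)
  case (insert l A)
  then show ?case using lin_opD(1)[OF assms, of "f l" "\<lambda>i. \<Sum>l\<in>A. f l i"] by simp
qed (simp_all add: lin_op_zero[OF assms])

lemma lin_op_funpow: "lin_op T \<Longrightarrow> lin_op (T ^^ m)"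
  by (induction m) (auto simp: lin_op_def)

lemma seminormD:
  assumes "seminorm \<nu>"
  shows "\<nu> (\<lambda>i. x i + y i) \<le> \<nu> x + \<nu> y" "\<nu> (\<lambda>i. c * x i) = cmod c * \<nu> x"
  using assms by (auto simp: seminorm_def)

lemma seminorm_zero: "seminorm \<nu> \<Longrightarrow> \<nu> (\<lambda>i. 0) = 0"
  using seminormD(2)[of \<nu> 0 "\<lambda>i. 0"] by simp

lemma seminorm_nonneg: "seminorm \<nu> \<Longrightarrow> 0 \<le> \<nu> x"
  using seminormD(1)[of \<nu> x "\<lambda>i. -1 * x i"] seminormD(2)[of \<nu> "-1" x] seminorm_zero[of \<nu>] by simp

text \<open>Horner's scheme for f(T) x, with T applied to the argument instead of the result: the
  recursion equation then holds without linearity of T.\<close>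

definition op_poly :: "((nat \<Rightarrow> complex) \<Rightarrow> nat \<Rightarrow> complex) \<Rightarrow> complex poly \<Rightarrow>
    (nat \<Rightarrow> complex) \<Rightarrow> nat \<Rightarrow> complex" where
  "op_poly T f = fold_coeffs (\<lambda>a g x i. a * x i + g (T x) i) f (\<lambda>x i. 0)"

lemma op_poly_0 [simp]: "op_poly T 0 x = (\<lambda>i. 0)"
  by (simp add: op_poly_def)

lemma op_poly_pCons [simp]: "op_poly T (pCons a f) x = (\<lambda>i. a * x i + op_poly T f (T x) i)"
  by (cases "f = 0"; cases "a = 0") (auto simp: op_poly_def)

lemma lin_op_op_poly: "lin_op T \<Longrightarrow> lin_op (op_poly T f)"
  by (induction f) (auto simp: lin_op_def algebra_simps)

lemma op_poly_commute:
  assumes "lin_op T"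
  shows "op_poly T f (T x) = T (op_poly T f x)"
  by (induction f arbitrary: x) (simp_all add: lin_op_zero[OF assms] lin_opD[OF assms])

lemma op_poly_add: "op_poly T (f + g) x = (\<lambda>i. op_poly T f x i + op_poly T g x i)"
  by (induction f g arbitrary: x rule: poly_induct2) (auto simp: algebra_simps)

lemma op_poly_smult: "op_poly T (Polynomial.smult c f) x = (\<lambda>i. c * op_poly T f x i)"
  by (induction f arbitrary: x) (auto simp: algebra_simps)

lemma op_poly_sum: "op_poly T (\<Sum>l\<in>A. f l) x = (\<lambda>i. \<Sum>l\<in>A. op_poly T (f l) x i)"
  by (induction A rule: infinite_finite_induct) (auto simp: op_poly_add)

lemma op_poly_mult:
  assumes "lin_op T"
  shows "op_poly T (f * g) x = op_poly T f (op_poly T g x)"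
proof (induction f arbitrary: x)
  case (pCons a f)
  have "op_poly T (pCons a f * g) x = (\<lambda>i. a * op_poly T g x i + op_poly T (f * g) (T x) i)"
    by (simp add: mult_pCons_left op_poly_add op_poly_smult)
  then show ?case by (simp add: pCons.IH op_poly_commute[OF assms])
qed simp

lemma op_poly_linear_factor:
  assumes "lin_op T"
  shows "op_poly T ([:-a, 1:] * f) x = op_poly T f (\<lambda>i. T x i - a * x i)"
  using op_poly_mult[OF assms, of f "[:-a, 1:]" x] by (simp add: mult.commute)

definition mat_op :: "nat \<Rightarrow> (nat \<Rightarrow> nat \<Rightarrow> complex) \<Rightarrow> (nat \<Rightarrow> complex) \<Rightarrow> nat \<Rightarrow> complex" where
  "mat_op n k x = (\<lambda>i. if i < n then \<Sum>j<n. k i j * x j else 0)"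

lemma lin_op_mat_op: "lin_op (mat_op n k)"
  by (auto simp: lin_op_def mat_op_def algebra_simps sum.distrib sum_distrib_left)

text \<open>The adjugate argument. With unit vectors e_j, column l of C = X - A gives sum_j C_jl(T)
  e_j = T e_l - sum_j k_jl e_j = 0. Weighting these relations with the entries K_li of the adjugate
  and using that C K is \<open>char_poly A\<close> times the identity collapses them to the
  claim.\<close>

lemma cayley_hamilton_basis:
  fixes n :: nat and k :: "nat \<Rightarrow> nat \<Rightarrow> complex"
  defines "A \<equiv> mat n n (\<lambda>(i, j). k i j)"
  assumes i: "i < n"
  shows "op_poly (mat_op n k) (char_poly A) (\<lambda>j. of_bool (j = i)) = (\<lambda>_. 0)"
proof -
  define T where "T = mat_op n k"
  define e :: "nat \<Rightarrow> nat \<Rightarrow> complex" where "e = (\<lambda>l j. of_bool (j = l))"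
  define C where "C = char_poly_matrix A"
  define K where "K = adj_mat C"
  have lT: "lin_op T" by (simp add: T_def lin_op_mat_op)
  have A: "A \<in> carrier_mat n n" by (simp add: A_def)
  have C: "C \<in> carrier_mat n n" using A by (simp add: C_def)
  have Centry: "C $$ (j, l) = [:- k j l, of_bool (j = l):]" if "j < n" "l < n" for j l
    using that by (auto simp: C_def char_poly_matrix_def A_def)
  have Kc: "K \<in> carrier_mat n n" and CK: "C * K = char_poly A \<cdot>\<^sub>m 1\<^sub>m n"
    using adj_mat[OF C] by (auto simp: K_def C_def char_poly_def)
  have CKe: "(\<Sum>l<n. K $$ (l, i) * C $$ (j, l)) = (if j = i then char_poly A else 0)" if j: "j < n" for j
  proof -
    have "(C * K) $$ (j, i) = (\<Sum>l<n. C $$ (j, l) * K $$ (l, i))"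
      using C Kc i j by (auto simp: scalar_prod_def atLeast0LessThan intro!: sum.cong)
    moreover have "(C * K) $$ (j, i) = (if j = i then char_poly A else 0)"
      using i j by (simp add: CK)
    ultimately show ?thesis by (simp add: mult.commute)
  qed
  have Te: "T (e l) = (\<lambda>i. \<Sum>j<n. k j l * e j i)" if "l < n" for l
    using that by (auto simp: T_def e_def mat_op_def sum.delta' if_distrib of_bool_def cong: if_cong)
  have col: "(\<lambda>i. \<Sum>j<n. op_poly T (C $$ (j, l)) (e j) i) = (\<lambda>_. 0)" if l: "l < n" for l
  proof
    fix q
    have "(\<Sum>j<n. op_poly T (C $$ (j, l)) (e j) q) = (\<Sum>j<n. - (k j l * e j q) + (if j = l then T (e j) q else 0))"
      using l by (intro sum.cong) (auto simp: Centry)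
    also have "\<dots> = - (\<Sum>j<n. k j l * e j q) + T (e l) q"
      using l by (simp only: sum.distrib sum_negf) simp
    also have "\<dots> = 0" by (simp add: Te[OF l])
    finally show "(\<Sum>j<n. op_poly T (C $$ (j, l)) (e j) q) = 0" .
  qed
  have "op_poly T (char_poly A) (e i) = (\<lambda>q. \<Sum>j<n. op_poly T (if j = i then char_poly A else 0) (e j) q)"
  proof
    fix q
    have "(\<Sum>j<n. op_poly T (if j = i then char_poly A else 0) (e j) q)
        = (\<Sum>j<n. if j = i then op_poly T (char_poly A) (e j) q else 0)"
      by (intro sum.cong) auto
    then show "op_poly T (char_poly A) (e i) q = (\<Sum>j<n. op_poly T (if j = i then char_poly A else 0) (e j) q)"
      using i by simp
  qed
  also have "\<dots> = (\<lambda>q. \<Sum>j<n. \<Sum>l<n. op_poly T (K $$ (l, i)) (op_poly T (C $$ (j, l)) (e j)) q)"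
    by (intro ext sum.cong refl) (simp add: CKe[symmetric] op_poly_sum op_poly_mult[OF lT])
  also have "\<dots> = (\<lambda>q. \<Sum>l<n. op_poly T (K $$ (l, i)) (\<lambda>i. \<Sum>j<n. op_poly T (C $$ (j, l)) (e j) i) q)"
    by (subst sum.swap) (simp add: lin_op_sum[OF lin_op_op_poly[OF lT]])
  also have "\<dots> = (\<lambda>_. 0)"
    by (simp add: col lin_op_zero[OF lin_op_op_poly[OF lT]])
  finally show ?thesis by (simp add: T_def e_def)
qed

text \<open>Linearity extends the claim from unit vectors. At an index from \<open>n\<close> on,
  f(T) multiplies the entry by the constant coefficient of f, whence the support condition.\<close>

lemma cayley_hamilton:
  fixes k :: "nat \<Rightarrow> nat \<Rightarrow> complex"
  assumes supp: "\<And>i. i \<ge> n \<Longrightarrow> x i = 0"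
  shows "op_poly (mat_op n k) (char_poly (mat n n (\<lambda>(i, j). k i j))) x = (\<lambda>_. 0)"
proof -
  have x: "x = (\<lambda>j. \<Sum>i<n. x i * of_bool (j = i))"
    using supp by (auto simp: of_bool_def if_distrib cong: if_cong)
  let ?P = "op_poly (mat_op n k) (char_poly (mat n n (\<lambda>(i, j). k i j)))"
  have lin: "lin_op ?P" by (intro lin_op_op_poly lin_op_mat_op)
  have "?P x = ?P (\<lambda>j. \<Sum>i<n. x i * of_bool (j = i))" using x by (rule arg_cong)
  also have "\<dots> = (\<lambda>j. \<Sum>i<n. x i * ?P (\<lambda>j. of_bool (j = i)) j)"
    unfolding lin_op_sum[OF lin] lin_opD(2)[OF lin] ..
  also have "\<dots> = (\<lambda>_. 0)" by (simp add: cayley_hamilton_basis)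
  finally show ?thesis .
qed

section \<open>Resolvents of contractions\<close>

text \<open>This is the sum of z^(m-1-j) T^j over j < m, that is, the quotient (z^m - T^m) / (z -
  T).\<close>

primrec geometric_op :: "((nat \<Rightarrow> complex) \<Rightarrow> nat \<Rightarrow> complex) \<Rightarrow> complex \<Rightarrow> nat \<Rightarrow>
    (nat \<Rightarrow> complex) \<Rightarrow> nat \<Rightarrow> complex" where
  "geometric_op T z 0 x = (\<lambda>i. 0)"
| "geometric_op T z (Suc m) x = (\<lambda>i. (T ^^ m) x i + z * geometric_op T z m x i)"

lemma lin_op_geometric_op: "lin_op T \<Longrightarrow> lin_op (geometric_op T z m)"
proof (induction m)
  case (Suc m)
  then show ?case
    using lin_opD[OF lin_op_funpow[OF Suc.prems, of m]] by (auto simp: lin_op_def algebra_simps)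
qed (simp add: lin_op_def)

lemma geometric_op_telescope:
  assumes "lin_op T"
  shows "geometric_op T z m (\<lambda>i. z * x i - T x i) = (\<lambda>i. z ^ m * x i - (T ^^ m) x i)"
proof (induction m)
  case (Suc m)
  have "(T ^^ m) (\<lambda>i. z * x i - T x i) = (\<lambda>i. z * (T ^^ m) x i - (T ^^ Suc m) x i)"
    by (simp add: lin_op_diff[OF lin_op_funpow[OF assms]] funpow_swap1)
  then show ?case by (simp add: Suc.IH algebra_simps)
qed simp

lemma seminorm_funpow_le:
  assumes "\<And>x. \<nu> (T x) \<le> \<nu> x"
  shows "\<nu> ((T ^^ m) x) \<le> (\<nu> x :: real)"
  by (induction m) (use assms order_trans in auto)

text \<open>Each of the m terms is at most |z|^(m-1) \<nu>(x), since T is a contraction. The weaker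
  factor |z|^m is convenient for the later division by z^m - a^m, whose modulus is at least |z|^m /
  2.\<close>

lemma geometric_op_bound:
  assumes \<nu>: "seminorm \<nu>" and T: "\<And>x. \<nu> (T x) \<le> \<nu> x" and z: "cmod z \<ge> 1"
  shows "\<nu> (geometric_op T z m x) \<le> real m * cmod z ^ m * \<nu> x"
proof (induction m)
  case 0
  then show ?case by (simp add: seminorm_zero[OF \<nu>])
next
  case (Suc m)
  have "\<nu> (geometric_op T z (Suc m) x) \<le> \<nu> ((T ^^ m) x) + cmod z * \<nu> (geometric_op T z m x)"
    using seminormD(1)[OF \<nu>, of "(T ^^ m) x" "\<lambda>i. z * geometric_op T z m x i"]
    by (simp add: seminormD(2)[OF \<nu>])
  also have "\<dots> \<le> \<nu> x + cmod z * (real m * cmod z ^ m * \<nu> x)"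
    using seminorm_funpow_le[of \<nu> T, OF T] Suc.IH by (intro add_mono mult_left_mono) auto
  also have "\<dots> \<le> cmod z ^ Suc m * \<nu> x + cmod z * (real m * cmod z ^ m * \<nu> x)"
    using mult_right_mono[OF one_le_power[OF z, of "Suc m"] seminorm_nonneg[OF \<nu>, of x]] by simp
  finally show ?case by (simp add: algebra_simps)
qed

text \<open>
  The operator \<open>G\<close> is a product of the factors \<open>(T\<^sup>m - a\<^sup>m) / (z\<^sup>m - a\<^sup>m)\<close>. Passing to \<open>m\<close>-th powers with
  \<open>r\<^sup>m \<le> 1 / 2\<close> bounds each factor by 3, whereas \<open>(T - a) / (z - a)\<close> would cost a power of \<open>1 / (1 - r)\<close>.
\<close>

lemma approximate_resolvent:
  assumes lT: "lin_op T" and \<nu>: "seminorm \<nu>" and T: "\<And>x. \<nu> (T x) \<le> \<nu> x"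
    and z: "cmod z \<ge> 1" and r: "0 \<le> r" "r ^ m \<le> 1 / 2"
    and as: "\<And>a. a \<in> set as \<Longrightarrow> cmod a \<le> r"
  shows "\<exists>F G. lin_op F \<and> lin_op G \<and> (\<forall>x. G (T x) = T (G x))
    \<and> (\<forall>x. F (\<lambda>i. z * x i - T x i) = (\<lambda>i. x i - G x i))
    \<and> (\<forall>x. \<nu> (F x) \<le> real m * (3 ^ length as - 1) * \<nu> x)
    \<and> (\<forall>x. \<nu> (G x) \<le> 3 ^ length as * \<nu> x)
    \<and> (\<forall>x. op_poly T (\<Prod>a\<leftarrow>as. [:-a, 1:]) x = (\<lambda>i. 0) \<longrightarrow> G x = (\<lambda>i. 0))"
  using as
proof (induction as)
  case Nil
  show ?case
    by (intro exI[of _ "\<lambda>x i. 0"] exI[of _ "\<lambda>x. x"])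
      (auto simp: lin_op_def seminorm_zero[OF \<nu>] one_pCons)
next
  case (Cons a as)
  then obtain F G where F: "lin_op F" and G: "lin_op G" and GT: "\<And>x. G (T x) = T (G x)"
    and FG: "\<And>x. F (\<lambda>i. z * x i - T x i) = (\<lambda>i. x i - G x i)"
    and Fb: "\<And>x. \<nu> (F x) \<le> real m * (3 ^ length as - 1) * \<nu> x"
    and Gb: "\<And>x. \<nu> (G x) \<le> 3 ^ length as * \<nu> x"
    and G0: "\<And>x. op_poly T (\<Prod>a\<leftarrow>as. [:-a, 1:]) x = (\<lambda>i. 0) \<Longrightarrow> G x = (\<lambda>i. 0)"
    by auto
  define d where "d = z ^ m - a ^ m"
  \<comment> \<open>With g = (T^m - a^m) / d and h the geometric sum over d, telescoping gives h (z
    - T) = 1 - g: one factor of G together with its share of F.\<close>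
  define h where "h = (\<lambda>x i. inverse d * geometric_op T z m x i)"
  define g where "g = (\<lambda>x i. inverse d * (T ^^ m) x i + (- inverse d * a ^ m) * x i)"
  have zm: "cmod z ^ m \<ge> 1" using z by (rule one_le_power)
  have am: "cmod a ^ m \<le> 1 / 2"
    using power_mono[of "cmod a" r m] r(2) Cons.prems by force
  \<comment> \<open>The bound r^m \<le> 1/2 keeps d away from 0, uniformly in how close r is to
    1.\<close>
  have dge: "cmod d \<ge> cmod z ^ m - 1 / 2"
    using norm_triangle_ineq2[of "z ^ m" "a ^ m"] am by (simp add: d_def norm_power)
  then have dge': "cmod d \<ge> cmod z ^ m / 2" "cmod d \<ge> 1 / 2" using zm by auto
  then have d0: "d \<noteq> 0" by auto
  have hb: "\<nu> (h y) \<le> 2 * real m * \<nu> y" for y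
  proof -
    have "\<nu> (h y) \<le> inverse (cmod d) * (real m * cmod z ^ m * \<nu> y)"
      using seminormD(2)[OF \<nu>, of "inverse d" "geometric_op T z m y"] geometric_op_bound[OF \<nu> T z, of m y]
      by (simp add: h_def norm_inverse mult_left_mono)
    also have "\<dots> = (cmod z ^ m / cmod d) * (real m * \<nu> y)" by (simp add: field_simps)
    also have "\<dots> \<le> 2 * (real m * \<nu> y)"
      using dge' d0 seminorm_nonneg[OF \<nu>, of y] by (intro mult_right_mono) (auto simp: field_simps)
    finally show ?thesis by simp
  qed
  have gb: "\<nu> (g y) \<le> 3 * \<nu> y" for y
  proof -
    have "\<nu> (g y) \<le> inverse (cmod d) * \<nu> ((T ^^ m) y) + inverse (cmod d) * cmod a ^ m * \<nu> y"
      unfolding g_def by (rule order_trans[OF seminormD(1)[OF \<nu>]])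
        (simp add: seminormD(2)[OF \<nu>] seminormD(2)[OF \<nu>, of "- (inverse d * a ^ m)", simplified] norm_inverse norm_mult norm_power)
    also have "\<dots> \<le> inverse (cmod d) * \<nu> y + inverse (cmod d) * (1 / 2) * \<nu> y"
      using seminorm_funpow_le[of \<nu> T, OF T] am seminorm_nonneg[OF \<nu>, of y]
      by (intro add_mono mult_left_mono mult_right_mono) auto
    also have "\<dots> = inverse (cmod d) * (3 / 2 * \<nu> y)" by (simp add: algebra_simps)
    also have "\<dots> \<le> 2 * (3 / 2 * \<nu> y)"
      using dge' d0 seminorm_nonneg[OF \<nu>, of y] by (intro mult_right_mono) (auto simp: field_simps)
    finally show ?thesis by simp
  qed
  have hlin: "lin_op h"
    using lin_opD[OF lin_op_geometric_op[OF lT, of z m]] by (auto simp: lin_op_def h_def algebra_simps)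
  have glin: "lin_op g"
    using lin_opD[OF lin_op_funpow[OF lT, of m]] by (auto simp: lin_op_def g_def algebra_simps)
  have hg: "h (\<lambda>i. z * y i - T y i) = (\<lambda>i. y i - g y i)" for y
  proof
    fix i
    have "inverse d * z ^ m = 1 + inverse d * a ^ m" using d0 by (simp add: field_simps d_def)
    then have "inverse d * (z ^ m * y i) = (1 + inverse d * a ^ m) * y i" by (metis mult.assoc)
    then show "h (\<lambda>i. z * y i - T y i) i = y i - g y i"
      by (simp add: h_def g_def geometric_op_telescope[OF lT] algebra_simps)
  qed
  have gT: "g (T y) = T (g y)" for y
    unfolding g_def lin_op_comb[OF lT] by (simp add: funpow_swap1)
  have Gdiff: "G (\<lambda>i. z * x i - T x i) = (\<lambda>i. z * G x i - T (G x) i)" for x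
    by (simp add: lin_op_diff[OF G] GT)
  \<comment> \<open>Since G commutes with T, (F + h G)(z - T) = 1 - G + (1 - g) G = 1 - g G.\<close>
  define F' where "F' = (\<lambda>x i. F x i + h (G x) i)"
  define G' where "G' = (\<lambda>x. g (G x))"
  have c1: "lin_op F'" "lin_op G'"
    by (auto simp: lin_op_def F'_def G'_def algebra_simps lin_opD[OF F] lin_opD[OF G]
        lin_opD[OF hlin] lin_opD[OF glin])
  have c2: "G' (T x) = T (G' x)" for x by (simp add: G'_def GT gT)
  have c3: "F' (\<lambda>i. z * x i - T x i) = (\<lambda>i. x i - G' x i)" for x
    by (simp add: F'_def G'_def FG Gdiff hg)
  have c4: "\<nu> (G' x) \<le> 3 ^ length (a # as) * \<nu> x" for x
    using gb[of "G x"] Gb[of x] by (simp add: G'_def)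
  \<comment> \<open>The constants add up: m (3^k - 1) + 2 m 3^k = m (3^(k+1) - 1).\<close>
  have c5: "\<nu> (F' x) \<le> real m * (3 ^ length (a # as) - 1) * \<nu> x" for x
  proof -
    have "\<nu> (F' x) \<le> \<nu> (F x) + \<nu> (h (G x))" unfolding F'_def by (rule seminormD(1)[OF \<nu>])
    also have "\<dots> \<le> real m * (3 ^ length as - 1) * \<nu> x + 2 * real m * (3 ^ length as * \<nu> x)"
      using Fb[of x] order_trans[OF hb[of "G x"] mult_left_mono[OF Gb[of x]]] by force
    finally show ?thesis by (simp add: algebra_simps)
  qed
  \<comment> \<open>By induction G annihilates (T - a) x, so T maps G x to a G x; hence g, a
    multiple of T^m - a^m, annihilates G x.\<close>
  have c6: "G' x = (\<lambda>i. 0)" if "op_poly T (\<Prod>a\<leftarrow>a # as. [:-a, 1:]) x = (\<lambda>i. 0)" for x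
  proof -
    have "op_poly T (\<Prod>a\<leftarrow>as. [:-a, 1:]) (\<lambda>i. T x i - a * x i) = (\<lambda>i. 0)"
      using that op_poly_linear_factor[OF lT, of a] by simp
    then have "G (\<lambda>i. T x i - a * x i) = (\<lambda>i. 0)" by (rule G0)
    moreover have "G (\<lambda>i. T x i - a * x i) = (\<lambda>i. T (G x) i - a * G x i)"
      using lin_op_comb[OF G, of 1 "T x" "- a" x] by (simp add: GT)
    ultimately have ev: "T (G x) = (\<lambda>i. a * G x i)" by (auto simp: fun_eq_iff)
    have "(T ^^ l) (G x) = (\<lambda>i. a ^ l * G x i)" for l
    proof (induction l)
      case (Suc l)
      then have "(T ^^ Suc l) (G x) = (\<lambda>i. a ^ l * (a * G x i))"
        by (simp add: lin_opD(2)[OF lT] ev)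
      then show ?case by (simp add: mult_ac)
    qed simp
    then show ?thesis by (simp add: G'_def g_def)
  qed
  show ?case
    by (intro exI[of _ F'] exI[of _ G'] conjI allI impI c1 c2 c3 c4 c5 c6)
qed

text \<open>Cayley-Hamilton makes f(T) x, with f the product over \<open>as\<close>, a fixed vector
  of T, and the invariant functional w takes the value f(1) w(x) = 0 on it. By \<open>ker\<close> it
  vanishes, so G x = 0 and the approximate inverse F of z - T is exact at x. The same F serves all
  such x.\<close>

lemma reduced_resolvent:
  fixes n :: nat and k :: "nat \<Rightarrow> nat \<Rightarrow> complex"
  defines "T \<equiv> mat_op n k"
  assumes \<nu>: "seminorm \<nu>" "\<And>x. \<nu> (T x) \<le> \<nu> x"
    and z: "cmod z \<ge> 1" and r: "0 \<le> r" "r ^ m \<le> 1 / 2"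
    and as: "\<And>a. a \<in> set as \<Longrightarrow> cmod a \<le> r"
    and cp: "char_poly (mat n n (\<lambda>(i, j). k i j)) = [:-1, 1:] * (\<Prod>a\<leftarrow>as. [:-a, 1:])"
    and inv: "\<And>j. j < n \<Longrightarrow> (\<Sum>i<n. w i * k i j) = w j"
    and ker: "\<And>x. (\<And>i. i < n \<Longrightarrow> (\<Sum>j<n. k i j * x j) = x i) \<Longrightarrow> (\<Sum>i<n. w i * x i) = 0 \<Longrightarrow> \<forall>i<n. x i = 0"
  obtains F where "lin_op F" "\<And>x. \<nu> (F x) \<le> real m * (3 ^ length as - 1) * \<nu> x"
    "\<And>x. (\<And>i. i \<ge> n \<Longrightarrow> x i = 0) \<Longrightarrow> (\<Sum>i<n. w i * x i) = 0 \<Longrightarrow> F (\<lambda>i. z * x i - T x i) = x"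
proof -
  define f where "f = (\<Prod>a\<leftarrow>as. [:-a, 1:])"
  have lT: "lin_op T" by (simp add: T_def lin_op_mat_op)
  obtain F G where F: "lin_op F" and FG: "\<And>x. F (\<lambda>i. z * x i - T x i) = (\<lambda>i. x i - G x i)"
    and Fb: "\<And>x. \<nu> (F x) \<le> real m * (3 ^ length as - 1) * \<nu> x"
    and G0: "\<And>x. op_poly T f x = (\<lambda>i. 0) \<Longrightarrow> G x = (\<lambda>i. 0)"
    using approximate_resolvent[OF lT \<nu> z r, of as, OF as] unfolding f_def by auto
  have wT: "(\<Sum>i<n. w i * T x i) = (\<Sum>i<n. w i * x i)" for x
  proof -
    have "(\<Sum>i<n. w i * T x i) = (\<Sum>i<n. \<Sum>j<n. w i * k i j * x j)"
      by (simp add: T_def mat_op_def sum_distrib_left mult.assoc)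
    also have "\<dots> = (\<Sum>j<n. (\<Sum>i<n. w i * k i j) * x j)"
      by (subst sum.swap) (simp add: sum_distrib_right)
    finally show ?thesis by (simp add: inv)
  qed
  have wp: "(\<Sum>i<n. w i * op_poly T p x i) = poly p 1 * (\<Sum>i<n. w i * x i)" for p x
  proof (induction p arbitrary: x)
    case (pCons a p)
    have "(\<Sum>i<n. w i * op_poly T (pCons a p) x i) = a * (\<Sum>i<n. w i * x i) + (\<Sum>i<n. w i * op_poly T p (T x) i)"
      by (simp add: algebra_simps sum.distrib sum_distrib_left)
    then show ?case by (simp add: pCons.IH wT algebra_simps)
  qed simp
  have supp: "op_poly T p x i = 0" if "\<And>i. i \<ge> n \<Longrightarrow> x i = 0" "i \<ge> n" for p x i
    using that by (induction p arbitrary: x) (auto simp: T_def mat_op_def)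
  have key: "F (\<lambda>i. z * x i - T x i) = x" if x: "\<And>i. i \<ge> n \<Longrightarrow> x i = 0" "(\<Sum>i<n. w i * x i) = 0" for x
  proof -
    let ?y = "op_poly T f x"
    have "op_poly T ([:-1, 1:] * f) x = (\<lambda>i. 0)"
      using cayley_hamilton[of n x k, OF x(1)] by (simp add: cp f_def T_def)
    then have "T ?y i = ?y i" for i
      unfolding op_poly_mult[OF lT] by (auto simp: fun_eq_iff)
    then have "(\<Sum>j<n. k i j * ?y j) = ?y i" if "i < n" for i
      using that by (metis T_def mat_op_def)
    then have "\<forall>i<n. ?y i = 0" by (rule ker) (simp_all add: wp x)
    then have "?y = (\<lambda>i. 0)" using supp[of x _ f] x(1) by (metis not_le)
    then show ?thesis by (simp add: FG G0)
  qed
  show ?thesis by (rule that[of F, OF F Fb key])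
qed

section \<open>Irreducible stochastic matrices\<close>

definition irreducible_fun :: "nat \<Rightarrow> (nat \<Rightarrow> nat \<Rightarrow> real) \<Rightarrow> bool" where
  "irreducible_fun n p \<longleftrightarrow> (\<forall>i<n. \<forall>j<n. (i, j) \<in> {(i, j). i < n \<and> j < n \<and> 0 < p i j}\<^sup>*)"

definition row_stochastic :: "nat \<Rightarrow> (nat \<Rightarrow> nat \<Rightarrow> real) \<Rightarrow> bool" where
  "row_stochastic n p \<longleftrightarrow> (\<forall>i<n. \<forall>j<n. 0 \<le> p i j) \<and> (\<forall>i<n. (\<Sum>j<n. p i j) = 1)"

lemma row_stochasticD:
  assumes "row_stochastic n p"
  shows "i < n \<Longrightarrow> j < n \<Longrightarrow> 0 \<le> p i j" "i < n \<Longrightarrow> (\<Sum>j<n. p i j) = 1"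
  using assms unfolding row_stochastic_def by blast+

text \<open>Maximum principle: where x attains its maximum M, the nonnegative terms p_aj (M - x_j)
  sum to 0, so every successor attains M too, and irreducibility carries this to all
  indices.\<close>

lemma harmonic_constant_real:
  fixes x :: "nat \<Rightarrow> real"
  assumes p: "row_stochastic n p" and irr: "irreducible_fun n p"
    and x: "\<And>i. i < n \<Longrightarrow> (\<Sum>j<n. p i j * x j) = x i" and ij: "i < n" "j < n"
  shows "x i = x j"
proof -
  define M where "M = Max (x ` {..<n})"
  have le: "x l \<le> M" if "l < n" for l using that by (auto simp: M_def)
  have "M \<in> x ` {..<n}" unfolding M_def using ij by (intro Max_in) auto
  then obtain m where m: "m < n" "x m = M" by auto
  have "x l = M" if "(m, l) \<in> {(i, j). i < n \<and> j < n \<and> 0 < p i j}\<^sup>*" for l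
    using that
  proof (induction rule: rtrancl_induct)
    case base
    then show ?case using m by simp
  next
    case (step a b)
    then have ab: "a < n" "b < n" "0 < p a b" by auto
    have "(\<Sum>j<n. p a j * (M - x j)) = M * (\<Sum>j<n. p a j) - (\<Sum>j<n. p a j * x j)"
      by (simp add: algebra_simps sum_subtractf sum_distrib_left)
    also have "\<dots> = 0" using ab x step.IH row_stochasticD(2)[OF p] by simp
    finally have "\<forall>j\<in>{..<n}. p a j * (M - x j) = 0"
      using ab le row_stochasticD(1)[OF p] by (subst (asm) sum_nonneg_eq_0_iff) auto
    then have "p a b * (M - x b) = 0" using ab by blast
    then show ?case using ab by simp
  qed
  then show ?thesis using irr m ij by (auto simp: irreducible_fun_def)
qed

lemma harmonic_constant:
  fixes x :: "nat \<Rightarrow> complex"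
  assumes p: "row_stochastic n p" and irr: "irreducible_fun n p"
    and x: "\<And>i. i < n \<Longrightarrow> (\<Sum>j<n. of_real (p i j) * x j) = x i" and ij: "i < n" "j < n"
  shows "x i = x j"
proof (rule complex_eqI)
  have "(\<Sum>j<n. p i j * Re (x j)) = Re (x i)" "(\<Sum>j<n. p i j * Im (x j)) = Im (x i)" if "i < n" for i
    using arg_cong[OF x[OF that], of Re] arg_cong[OF x[OF that], of Im] by simp_all
  then show "Re (x i) = Re (x j)" "Im (x i) = Im (x j)"
    using harmonic_constant_real[OF p irr _ ij, of "\<lambda>i. Re (x i)"]
      harmonic_constant_real[OF p irr _ ij, of "\<lambda>i. Im (x i)"] by simp_all
qed

definition stationary :: "nat \<Rightarrow> (nat \<Rightarrow> nat \<Rightarrow> real) \<Rightarrow> (nat \<Rightarrow> real) \<Rightarrow> bool" where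
  "stationary n p w \<longleftrightarrow> (\<forall>i<n. 0 \<le> w i) \<and> (\<Sum>i<n. w i) = 1 \<and> (\<forall>j<n. (\<Sum>i<n. w i * p i j) = w j)"

lemma stationaryD:
  assumes "stationary n p w"
  shows "i < n \<Longrightarrow> 0 \<le> w i" "(\<Sum>i<n. w i) = 1" "j < n \<Longrightarrow> (\<Sum>i<n. w i * p i j) = w j"
  using assms unfolding stationary_def by blast+

lemma stochastic_eigenvalue_1:
  assumes p: "row_stochastic n p" and n: "n > 0"
  shows "eigenvalue (mat n n (\<lambda>(i, j). complex_of_real (p i j))) 1"
proof -
  define u :: "complex vec" where "u = vec n (\<lambda>_. 1)"
  have "mat n n (\<lambda>(i, j). complex_of_real (p i j)) *\<^sub>v u = 1 \<cdot>\<^sub>v u"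
    using row_stochasticD(2)[OF p]
    by (intro eq_vecI) (auto simp: u_def scalar_prod_def atLeast0LessThan simp flip: of_real_sum)
  moreover have "u \<noteq> 0\<^sub>v n"
  proof
    assume "u = 0\<^sub>v n"
    then have "u $ 0 = 0\<^sub>v n $ 0" by simp
    with n show False by (simp add: u_def)
  qed
  ultimately show ?thesis
    unfolding eigenvalue_def eigenvector_def by (auto simp: u_def intro!: exI[of _ u])
qed

text \<open>The normalised moduli of a left eigenvector v for the eigenvalue 1 work: |v| \<le> |v| p
  entrywise by the triangle inequality, and both sides have the same total since the rows of p sum
  to 1, so equality holds.\<close>

lemma stationary_exists:
  assumes p: "row_stochastic n p" and n: "n > 0"
  obtains w where "stationary n p w"
proof -
  define A where "A = mat n n (\<lambda>(i, j). complex_of_real (p i j))"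
  have A: "A \<in> carrier_mat n n" by (simp add: A_def)
  have "eigenvalue A 1" unfolding A_def by (rule stochastic_eigenvalue_1[OF p n])
  then have "eigenvalue (transpose_mat A) 1"
    using eigenvalue_root_char_poly[OF A] eigenvalue_root_char_poly[of "transpose_mat A" n] A by simp
  then obtain v where v: "v \<in> carrier_vec n" "v \<noteq> 0\<^sub>v n" "transpose_mat A *\<^sub>v v = 1 \<cdot>\<^sub>v v"
    unfolding eigenvalue_def eigenvector_def using A by auto
  have vj: "(\<Sum>i<n. v $ i * of_real (p i j)) = v $ j" if "j < n" for j
  proof -
    have "(transpose_mat A *\<^sub>v v) $ j = (\<Sum>i<n. v $ i * of_real (p i j))"
      using that v(1) by (simp add: A_def scalar_prod_def atLeast0LessThan mult.commute)
    then show ?thesis using v that by simp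
  qed
  have le: "cmod (v $ j) \<le> (\<Sum>i<n. cmod (v $ i) * p i j)" if "j < n" for j
  proof -
    have "cmod (v $ j) \<le> (\<Sum>i<n. cmod (v $ i * of_real (p i j)))"
      using norm_sum by (subst vj[OF that, symmetric]) blast
    also have "\<dots> = (\<Sum>i<n. cmod (v $ i) * p i j)"
      using that row_stochasticD(1)[OF p] by (intro sum.cong) (auto simp: norm_mult)
    finally show ?thesis .
  qed
  have "(\<Sum>j<n. (\<Sum>i<n. cmod (v $ i) * p i j) - cmod (v $ j)) = (\<Sum>i<n. \<Sum>j<n. cmod (v $ i) * p i j) - (\<Sum>j<n. cmod (v $ j))"
    by (simp add: sum_subtractf) (rule sum.swap)
  also have "\<dots> = 0" using row_stochasticD(2)[OF p] by (simp flip: sum_distrib_left)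
  finally have "\<forall>j\<in>{..<n}. (\<Sum>i<n. cmod (v $ i) * p i j) - cmod (v $ j) = 0"
    using le by (subst (asm) sum_nonneg_eq_0_iff) auto
  then have eq: "(\<Sum>i<n. cmod (v $ i) * p i j) = cmod (v $ j)" if "j < n" for j using that by auto
  define s where "s = (\<Sum>i<n. cmod (v $ i))"
  obtain i where i: "i < n" "v $ i \<noteq> 0"
    using v(1,2) by (metis carrier_vecD eq_vecI index_zero_vec)
  have "s > 0" unfolding s_def using i by (intro sum_pos2[of _ i]) auto
  then have "stationary n p (\<lambda>i. cmod (v $ i) / s)"
    by (auto simp: stationary_def eq s_def simp flip: sum_divide_distrib)
  then show ?thesis by (rule that)
qed

text \<open>Mass at a single index spreads along the positive entries, because w_b \<ge> w_a
  p_ab.\<close>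

lemma stationary_pos:
  assumes p: "row_stochastic n p" and irr: "irreducible_fun n p" and w: "stationary n p w"
    and j: "j < n"
  shows "0 < w j"
proof -
  obtain i where i: "i < n" "0 < w i"
  proof (rule ccontr)
    assume "\<not> thesis"
    then have "w i \<le> 0" if "i < n" for i using that \<open>\<And>i. i < n \<Longrightarrow> 0 < w i \<Longrightarrow> thesis\<close> not_le by blast
    then have "(\<Sum>i<n. w i) \<le> 0" by (intro sum_nonpos) auto
    then show False using stationaryD(2)[OF w] by simp
  qed
  have "0 < w l" if "(i, l) \<in> {(i, j). i < n \<and> j < n \<and> 0 < p i j}\<^sup>*" for l
    using that
  proof (induction rule: rtrancl_induct)
    case (step a b)
    then have ab: "a < n" "b < n" "0 < p a b" by auto
    have "0 < (\<Sum>i<n. w i * p i b)"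
      using ab step.IH stationaryD(1)[OF w] row_stochasticD(1)[OF p] by (intro sum_pos2[of _ a]) auto
    then show ?case using stationaryD(3)[OF w] ab by simp
  qed (use i in simp)
  then show ?thesis using irr i j by (auto simp: irreducible_fun_def)
qed

text \<open>Dividing by the stationary vector turns left fixed vectors of \<open>p\<close> into harmonic functions
  of the time-reversed chain.\<close>

lemma left_fixed_vector_unique:
  fixes z :: "nat \<Rightarrow> complex"
  assumes p: "row_stochastic n p" and irr: "irreducible_fun n p" and w: "stationary n p w"
    and z: "\<And>j. j < n \<Longrightarrow> (\<Sum>i<n. z i * of_real (p i j)) = z j" and sum: "(\<Sum>i<n. z i) = 0"
    and l: "l < n"
  shows "z l = 0"
proof -
  note pos = stationary_pos[OF p irr w]
  define q where "q = (\<lambda>j i. w i * p i j / w j)"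
  have "row_stochastic n q"
    using row_stochasticD(1)[OF p] stationaryD[OF w] pos
    by (auto simp: row_stochastic_def q_def less_imp_neq[THEN not_sym] simp flip: sum_divide_distrib)
  moreover have "irreducible_fun n q"
  proof -
    have "{(i, j). i < n \<and> j < n \<and> 0 < q i j} = {(i, j). i < n \<and> j < n \<and> 0 < p i j}\<inverse>"
      using pos by (auto simp: q_def zero_less_mult_iff zero_less_divide_iff dest: pos less_asym)
    then show ?thesis using irr by (auto simp: irreducible_fun_def rtrancl_converse)
  qed
  moreover have "(\<Sum>i<n. of_real (q j i) * (z i / of_real (w i))) = z j / of_real (w j)" if j: "j < n" for j
  proof -
    have "(\<Sum>i<n. of_real (q j i) * (z i / of_real (w i))) = (\<Sum>i<n. z i * of_real (p i j)) / of_real (w j)"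
      unfolding sum_divide_distrib using pos by (intro sum.cong) (auto simp: q_def field_simps dest: pos)
    then show ?thesis by (simp add: z j)
  qed
  ultimately have const: "z i / of_real (w i) = z l / of_real (w l)" if "i < n" for i
    using harmonic_constant[of n q "\<lambda>i. z i / of_real (w i)" i l] that l by blast
  \<comment> \<open>So z is a multiple of w, and comparing totals, 0 against 1, makes the factor
    vanish.\<close>
  have zi: "z i = z l / of_real (w l) * of_real (w i)" if "i < n" for i
    using const[OF that] pos[OF that] by (simp add: field_simps)
  have "0 = (\<Sum>i<n. z l / of_real (w l) * of_real (w i))" using sum zi by simp
  also have "\<dots> = z l / of_real (w l) * of_real (\<Sum>i<n. w i)"
    by (simp only: of_real_sum sum_distrib_left)
  also have "\<dots> = z l / of_real (w l)" using stationaryD(2)[OF w] by simp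
  finally show ?thesis using pos[OF l] by simp
qed

section \<open>Contraction norms and resolvent bounds of the two chains\<close>

definition sup_norm :: "nat \<Rightarrow> (nat \<Rightarrow> complex) \<Rightarrow> real" where
  "sup_norm n x = Max ((\<lambda>i. cmod (x i)) ` {..<n})"

definition l1_norm :: "nat \<Rightarrow> (nat \<Rightarrow> complex) \<Rightarrow> real" where
  "l1_norm n x = (\<Sum>i<n. cmod (x i))"

lemma sup_norm_ge: "i < n \<Longrightarrow> cmod (x i) \<le> sup_norm n x"
  unfolding sup_norm_def by (rule Max_ge) auto

lemma sup_norm_le: "n > 0 \<Longrightarrow> (\<And>i. i < n \<Longrightarrow> cmod (x i) \<le> B) \<Longrightarrow> sup_norm n x \<le> B"
  unfolding sup_norm_def by (intro Max.boundedI) auto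

lemma seminorm_sup_norm:
  assumes "n > 0"
  shows "seminorm (sup_norm n)"
  unfolding seminorm_def
proof (intro conjI allI)
  fix x y :: "nat \<Rightarrow> complex"
  show "sup_norm n (\<lambda>i. x i + y i) \<le> sup_norm n x + sup_norm n y"
    using assms by (intro sup_norm_le order_trans[OF norm_triangle_ineq] add_mono sup_norm_ge)
next
  fix c :: complex and x :: "nat \<Rightarrow> complex"
  have "mono (\<lambda>t. cmod c * t)" by (auto intro!: monoI mult_left_mono)
  from mono_Max_commute[OF this, of "(\<lambda>i. cmod (x i)) ` {..<n}"]
  show "sup_norm n (\<lambda>i. c * x i) = cmod c * sup_norm n x"
    using assms by (simp add: sup_norm_def norm_mult image_image lessThan_empty_iff)
qed

lemma seminorm_l1_norm: "seminorm (l1_norm n)"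
  unfolding seminorm_def l1_norm_def
proof (intro conjI allI)
  show "(\<Sum>i<n. cmod (x i + y i)) \<le> (\<Sum>i<n. cmod (x i)) + (\<Sum>i<n. cmod (y i))" for x y
    unfolding sum.distrib[symmetric] by (intro sum_mono norm_triangle_ineq)
  show "(\<Sum>i<n. cmod (c * x i)) = cmod c * (\<Sum>i<n. cmod (x i))" for c x
    by (simp add: norm_mult sum_distrib_left)
qed

lemma sup_norm_mat_op_le:
  assumes n: "n > 0" and p: "row_stochastic n p"
  shows "sup_norm n (mat_op n (\<lambda>i j. of_real (p i j)) x) \<le> sup_norm n x"
proof (rule sup_norm_le[OF n])
  fix i assume i: "i < n"
  have "cmod (mat_op n (\<lambda>i j. of_real (p i j)) x i) \<le> (\<Sum>j<n. p i j * cmod (x j))"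
    using i row_stochasticD(1)[OF p]
    by (auto simp: mat_op_def norm_mult intro!: order_trans[OF norm_sum] sum_mono)
  also have "\<dots> \<le> (\<Sum>j<n. p i j * sup_norm n x)"
    using i row_stochasticD(1)[OF p] by (intro sum_mono mult_left_mono sup_norm_ge) auto
  also have "\<dots> = sup_norm n x" using i row_stochasticD(2)[OF p] by (simp flip: sum_distrib_right)
  finally show "cmod (mat_op n (\<lambda>i j. of_real (p i j)) x i) \<le> sup_norm n x" .
qed

text \<open>The swapped indices give a matrix whose columns sum to 1, which is the shape of
  \<open>S\<close>.\<close>

lemma l1_norm_mat_op_le:
  assumes p: "row_stochastic n p"
  shows "l1_norm n (mat_op n (\<lambda>i j. of_real (p j i)) x) \<le> l1_norm n x"
proof -
  have "l1_norm n (mat_op n (\<lambda>i j. of_real (p j i)) x) \<le> (\<Sum>i<n. \<Sum>j<n. p j i * cmod (x j))"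
    unfolding l1_norm_def using row_stochasticD(1)[OF p]
    by (auto simp: mat_op_def norm_mult intro!: sum_mono order_trans[OF norm_sum])
  also have "\<dots> = (\<Sum>j<n. \<Sum>i<n. p j i * cmod (x j))" by (rule sum.swap)
  also have "\<dots> = l1_norm n x"
    using row_stochasticD(2)[OF p] by (simp add: l1_norm_def flip: sum_distrib_right)
  finally show ?thesis .
qed

text \<open>An eigenvector for z has its 1-norm multiplied by |z|, which the contraction property
  limits to 1.\<close>

lemma stochastic_root_le_1:
  assumes p: "row_stochastic n p"
    and z: "poly (char_poly (mat n n (\<lambda>(i, j). complex_of_real (p j i)))) z = 0"
  shows "cmod z \<le> 1"
proof -
  define k where "k = (\<lambda>i j. complex_of_real (p j i))"
  define A where "A = mat n n (\<lambda>(i, j). k i j)"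
  have A: "A \<in> carrier_mat n n" by (simp add: A_def)
  obtain v where v: "v \<in> carrier_vec n" "v \<noteq> 0\<^sub>v n" "A *\<^sub>v v = z \<cdot>\<^sub>v v"
    using z eigenvalue_root_char_poly[OF A, of z] A
    unfolding A_def k_def eigenvalue_def eigenvector_def by auto
  have "mat_op n k (($) v) i = z * v $ i" if "i < n" for i
  proof -
    have "(A *\<^sub>v v) $ i = mat_op n k (($) v) i"
      using that v(1) by (simp add: A_def mat_op_def scalar_prod_def atLeast0LessThan)
    then show ?thesis using v that by simp
  qed
  then have "l1_norm n (mat_op n k (($) v)) = cmod z * l1_norm n (($) v)"
    by (simp add: l1_norm_def norm_mult sum_distrib_left)
  then have "cmod z * l1_norm n (($) v) \<le> 1 * l1_norm n (($) v)"
    using l1_norm_mat_op_le[OF p, of "($) v"] by (simp add: k_def)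
  moreover obtain i where "i < n" "v $ i \<noteq> 0"
    using v(1,2) by (metis carrier_vecD eq_vecI index_zero_vec)
  then have "0 < l1_norm n (($) v)" unfolding l1_norm_def by (intro sum_pos2[of _ i]) auto
  ultimately show ?thesis by (metis mult_le_cancel_right_pos)
qed

text \<open>\<open>reduced_resolvent\<close> for the functional w: a fixed vector of an irreducible
  chain is constant, and a constant of w-mean 0 is 0. Truncating x at \<open>n\<close> supplies the
  support condition.\<close>

lemma sup_resolvent_bound:
  fixes p :: "nat \<Rightarrow> nat \<Rightarrow> real"
  assumes n: "n > 0" and p: "row_stochastic n p" and irr: "irreducible_fun n p" and w: "stationary n p w"
    and z: "cmod z \<ge> 1" and r: "0 \<le> r" "r ^ m \<le> 1 / 2"
    and as: "\<And>a. a \<in> set as \<Longrightarrow> cmod a \<le> r"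
    and cp: "char_poly (mat n n (\<lambda>(i, j). complex_of_real (p i j))) = [:-1, 1:] * (\<Prod>a\<leftarrow>as. [:-a, 1:])"
    and x: "(\<Sum>i<n. of_real (w i) * x i) = 0"
    and B: "\<And>i. i < n \<Longrightarrow> cmod (z * x i - (\<Sum>j<n. of_real (p i j) * x j)) \<le> B"
    and i: "i < n"
  shows "cmod (x i) \<le> real m * (3 ^ length as - 1) * B"
proof -
  define k where "k = (\<lambda>i j. complex_of_real (p i j))"
  have ker: "\<forall>i<n. y i = 0" if y: "\<And>i. i < n \<Longrightarrow> (\<Sum>j<n. k i j * y j) = y i" "(\<Sum>i<n. of_real (w i) * y i) = 0" for y
  proof (intro allI impI)
    fix i assume i: "i < n"
    have "y j = y i" if "j < n" for j
      using harmonic_constant[OF p irr y(1)[unfolded k_def]] that i by blast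
    then have "0 = (\<Sum>j<n. of_real (w j) * y i)" using y(2) by simp
    also have "\<dots> = y i" using stationaryD(2)[OF w] by (simp flip: sum_distrib_right of_real_sum)
    finally show "y i = 0" by simp
  qed
  have inv: "(\<Sum>i<n. of_real (w i) * k i j) = of_real (w j)" if "j < n" for j
    using stationaryD(3)[OF w that] by (simp add: k_def flip: of_real_mult of_real_sum)
  obtain F where F: "\<And>x. sup_norm n (F x) \<le> real m * (3 ^ length as - 1) * sup_norm n x"
    and Fx: "\<And>x. (\<And>i. i \<ge> n \<Longrightarrow> x i = 0) \<Longrightarrow> (\<Sum>i<n. of_real (w i) * x i) = 0 \<Longrightarrow> F (\<lambda>i. z * x i - mat_op n k x i) = x"
    using reduced_resolvent[OF seminorm_sup_norm[OF n] sup_norm_mat_op_le[OF n p] z r as cp inv[unfolded k_def] ker[unfolded k_def]]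
    unfolding k_def by blast
  define y where "y = (\<lambda>i. if i < n then x i else 0)"
  have "F (\<lambda>i. z * y i - mat_op n k y i) = y" by (rule Fx) (simp_all add: y_def x)
  then have "sup_norm n y \<le> real m * (3 ^ length as - 1) * sup_norm n (\<lambda>i. z * y i - mat_op n k y i)"
    using F by metis
  also have "\<dots> \<le> real m * (3 ^ length as - 1) * B"
    using B by (intro mult_left_mono sup_norm_le[OF n]) (auto simp: y_def mat_op_def k_def)
  finally show ?thesis using sup_norm_ge[OF i, of y] i by (simp add: y_def)
qed

text \<open>\<open>reduced_resolvent\<close> for the functional that sums all entries, which is
  invariant because columns sum to 1. The operator F itself is returned, since its linearity serves
  later to split a right-hand side.\<close>

lemma l1_resolvent:
  fixes p :: "nat \<Rightarrow> nat \<Rightarrow> real"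
  assumes p: "row_stochastic n p" and irr: "irreducible_fun n p" and w: "stationary n p w"
    and z: "cmod z \<ge> 1" and r: "0 \<le> r" "r ^ m \<le> 1 / 2"
    and as: "\<And>a. a \<in> set as \<Longrightarrow> cmod a \<le> r"
    and cp: "char_poly (mat n n (\<lambda>(i, j). complex_of_real (p j i))) = [:-1, 1:] * (\<Prod>a\<leftarrow>as. [:-a, 1:])"
  obtains F where "lin_op F" "\<And>x. l1_norm n (F x) \<le> real m * (3 ^ length as - 1) * l1_norm n x"
    "\<And>x. (\<And>i. i \<ge> n \<Longrightarrow> x i = 0) \<Longrightarrow> (\<Sum>i<n. x i) = 0 \<Longrightarrow>
      F (\<lambda>i. z * x i - mat_op n (\<lambda>i j. of_real (p j i)) x i) = x"
proof -
  have ker: "\<forall>i<n. y i = 0" if "\<And>i. i < n \<Longrightarrow> (\<Sum>j<n. of_real (p j i) * y j) = y i" "(\<Sum>i<n. 1 * y i) = 0"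
    for y :: "nat \<Rightarrow> complex"
  proof (intro allI impI)
    fix l assume "l < n"
    then show "y l = 0"
      using that by (intro left_fixed_vector_unique[OF p irr w, of y]) (simp_all add: mult.commute)
  qed
  have inv: "(\<Sum>i<n. 1 * complex_of_real (p j i)) = 1" if "j < n" for j
    using row_stochasticD(2)[OF p that] by (simp flip: of_real_sum)
  obtain F where F: "lin_op F" "\<And>x. l1_norm n (F x) \<le> real m * (3 ^ length as - 1) * l1_norm n x"
    "\<And>x. (\<And>i. i \<ge> n \<Longrightarrow> x i = 0) \<Longrightarrow> (\<Sum>i<n. 1 * x i) = 0 \<Longrightarrow>
      F (\<lambda>i. z * x i - mat_op n (\<lambda>i j. of_real (p j i)) x i) = x"
    using reduced_resolvent[OF seminorm_l1_norm l1_norm_mat_op_le[OF p] z r as cp inv ker] by blast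
  show ?thesis
  proof (rule that[of F])
    show "F (\<lambda>i. z * x i - mat_op n (\<lambda>i j. of_real (p j i)) x i) = x"
      if "\<And>i. i \<ge> n \<Longrightarrow> x i = 0" "(\<Sum>i<n. x i) = 0" for x
      using that by (intro F(3)) simp_all
  qed (fact F)+
qed

section \<open>The perturbed eigenvalue problem\<close>

text \<open>The vector is the projection of c along v onto the vectors of sum 0; both c and the
  removed part have 1-norm at most the sum of the |c_i|.\<close>

lemma l1_norm_rank_one_le:
  assumes v: "\<And>i. i < n \<Longrightarrow> 0 \<le> v i" "(\<Sum>i<n. v i) = (1::real)"
  shows "l1_norm n (\<lambda>i. if i < n then c i - (\<Sum>j<n. c j) * of_real (v i) else 0) \<le> 2 * (\<Sum>i<n. cmod (c i))"
proof -
  let ?s = "\<Sum>j<n. c j"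
  have "l1_norm n (\<lambda>i. if i < n then c i - ?s * of_real (v i) else 0) \<le> (\<Sum>i<n. cmod (c i) + cmod ?s * v i)"
    unfolding l1_norm_def
  proof (intro sum_mono)
    fix i assume "i \<in> {..<n}"
    then have i: "i < n" by simp
    have "cmod (c i - ?s * of_real (v i)) \<le> cmod (c i) + cmod (?s * of_real (v i))"
      by (rule norm_triangle_ineq4)
    also have "\<dots> = cmod (c i) + cmod ?s * v i" using v(1)[OF i] by (simp add: norm_mult)
    finally show "cmod (if i < n then c i - ?s * of_real (v i) else 0) \<le> cmod (c i) + cmod ?s * v i"
      using i by simp
  qed
  also have "\<dots> = (\<Sum>i<n. cmod (c i)) + cmod ?s"
    by (simp add: sum.distrib v(2) flip: sum_distrib_left)
  also have "cmod ?s \<le> (\<Sum>i<n. cmod (c i))" by (rule norm_sum)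
  finally show ?thesis by simp
qed

lemma weighted_sum_le_l1_norm:
  assumes w: "\<And>i. i < n \<Longrightarrow> 0 \<le> w i" "(\<Sum>i<n. w i) = (1::real)"
  shows "cmod (\<Sum>i<n. of_real (w i) * y i) \<le> l1_norm n y"
proof -
  have w1: "w i \<le> 1" if "i < n" for i
    using member_le_sum[of i "{..<n}" w] w that by auto
  have "cmod (\<Sum>i<n. of_real (w i) * y i) \<le> (\<Sum>i<n. cmod (of_real (w i) * y i))" by (rule norm_sum)
  also have "\<dots> \<le> l1_norm n y"
    unfolding l1_norm_def using w(1) w1 by (intro sum_mono) (auto simp: norm_mult intro: mult_left_le_one_le)
  finally show ?thesis .
qed

text \<open>The deviation is the w-average of the differences s_i - s_j. Each involves at most two
  distinct entries of s, so the constant is 1 rather than 2.\<close>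

lemma deviation_le_l1_norm:
  assumes w: "\<And>i. i < n \<Longrightarrow> 0 \<le> w i" "(\<Sum>i<n. w i) = (1::real)" and i: "i < n"
  shows "cmod (s i - (\<Sum>j<n. of_real (w j) * s j)) \<le> l1_norm n s"
proof -
  have d: "cmod (s i - s j) \<le> l1_norm n s" if "j < n" for j
  proof (cases "j = i")
    case False
    have "cmod (s i - s j) \<le> (\<Sum>k\<in>{i, j}. cmod (s k))"
      using False norm_triangle_ineq4[of "s i" "s j"] by simp
    also have "\<dots> \<le> l1_norm n s" unfolding l1_norm_def using i that by (intro sum_mono2) auto
    finally show ?thesis .
  qed (simp add: l1_norm_def sum_nonneg)
  have "s i - (\<Sum>j<n. of_real (w j) * s j) = of_real (\<Sum>j<n. w j) * s i - (\<Sum>j<n. of_real (w j) * s j)"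
    by (simp add: w(2))
  also have "\<dots> = (\<Sum>j<n. of_real (w j) * (s i - s j))"
    unfolding of_real_sum sum_distrib_right by (simp add: algebra_simps sum_subtractf)
  finally have "cmod (s i - (\<Sum>j<n. of_real (w j) * s j)) \<le> (\<Sum>j<n. cmod (of_real (w j) * (s i - s j)))"
    using norm_sum by metis
  also have "\<dots> \<le> (\<Sum>j<n. w j * l1_norm n s)"
    using w(1) d by (intro sum_mono) (auto simp: norm_mult intro: mult_left_mono)
  also have "\<dots> = l1_norm n s" by (simp add: w(2) flip: sum_distrib_right)
  finally show ?thesis .
qed

lemma Re_ge_of_norm_diff_le: "cmod (X - 1) \<le> d \<Longrightarrow> 1 - d \<le> Re X"
  using abs_Re_le_cmod[of "X - 1"] by simp

text \<open>Geometrically, 1 / \<mu> = - X / c has real part below - 1/2, and inversion maps that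
  half-plane onto the open unit disc around -1. The proof avoids the division: it multiplies the
  equation by the conjugate of \<mu> and compares |\<mu>|^2 Re X = - c Re \<mu> with 2 Re \<mu> +
  |\<mu>|^2 \<ge> 0.\<close>

lemma perturbed_eigenvalue_inside:
  fixes \<mu> X :: complex and c :: real
  assumes "\<mu> * X = - of_real c" "0 < c" "c < 1" "1 / 2 \<le> Re X"
  shows "cmod (1 + \<mu>) < 1"
proof (rule ccontr)
  assume "\<not> cmod (1 + \<mu>) < 1"
  then have "1 \<le> (cmod (1 + \<mu>))\<^sup>2" by simp
  then have *: "0 \<le> 2 * Re \<mu> + (cmod \<mu>)\<^sup>2"
    unfolding cmod_power2 by (simp add: power2_eq_square algebra_simps)
  have "cnj \<mu> * (\<mu> * X) = - of_real c * cnj \<mu>" using assms(1) by simp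
  then have "of_real ((cmod \<mu>)\<^sup>2) * X = - of_real c * cnj \<mu>"
    by (metis complex_norm_square mult.assoc mult.commute of_real_power)
  then have "Re (of_real ((cmod \<mu>)\<^sup>2) * X) = Re (- of_real c * cnj \<mu>)" by simp
  then have eq: "(cmod \<mu>)\<^sup>2 * Re X = - c * Re \<mu>" by simp
  have "\<mu> \<noteq> 0" using assms by auto
  then have pos: "(cmod \<mu>)\<^sup>2 > 0" by simp
  have "(cmod \<mu>)\<^sup>2 * (1 / 2) \<le> (cmod \<mu>)\<^sup>2 * Re X" using assms(4) pos by (intro mult_left_mono) auto
  also have "\<dots> = c * (- Re \<mu>)" by (simp add: eq)
  also have "\<dots> \<le> c * ((cmod \<mu>)\<^sup>2 / 2)" using * assms(2) by (intro mult_left_mono) auto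
  also have "\<dots> < 1 * ((cmod \<mu>)\<^sup>2 / 2)" using assms(3) pos by (intro mult_strict_right_mono) auto
  finally show False by simp
qed

text \<open>\<open>Q\<close> and \<open>F\<close> abstract the resolvents of P on vectors of w-mean
  0 and of S on vectors of sum 0. \<open>e1\<close> and \<open>e2\<close> are the block rows of the
  eigenvalue equation, and \<open>e3\<close> excludes the consensus direction.\<close>

lemma no_unstable_eigenvector:
  fixes P S :: "nat \<Rightarrow> nat \<Rightarrow> real" and w v :: "nat \<Rightarrow> real" and x s :: "nat \<Rightarrow> complex"
    and l :: complex and \<epsilon> q :: real
  assumes n: "n > 0"
    and P: "row_stochastic n P"
    and w: "stationary n P w" and v: "stationary n (\<lambda>i j. S j i) v"
    and t: "0 < (\<Sum>i<n. w i * v i)"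
    and e1: "\<And>i. i < n \<Longrightarrow> l * x i = (\<Sum>j<n. of_real (P i j) * x j) + of_real \<epsilon> * s i"
    and e2: "\<And>i. i < n \<Longrightarrow> l * s i = x i - (\<Sum>j<n. of_real (P i j) * x j)
              + (\<Sum>j<n. of_real (S i j) * s j) - of_real \<epsilon> * s i"
    and e3: "(\<Sum>i<n. x i) + (\<Sum>i<n. s i) = 0"
    and Q: "\<And>y B i. (\<Sum>i<n. of_real (w i) * y i) = 0 \<Longrightarrow>
              (\<And>i. i < n \<Longrightarrow> cmod (l * y i - (\<Sum>j<n. of_real (P i j) * y j)) \<le> B) \<Longrightarrow> i < n \<Longrightarrow> cmod (y i) \<le> q * B"
    and F: "lin_op F" and Fb: "\<And>y. l1_norm n (F y) \<le> q * l1_norm n y"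
    and Finv: "\<And>y. (\<And>i. i \<ge> n \<Longrightarrow> y i = 0) \<Longrightarrow> (\<Sum>i<n. y i) = 0 \<Longrightarrow>
              F (\<lambda>i. l * y i - mat_op n (\<lambda>i j. of_real (S i j)) y i) = y"
    and l: "cmod l \<ge> 1" and \<epsilon>: "0 < \<epsilon>" and q: "6 \<le> q" and small: "4 * \<epsilon> * q * (2 * real n * q + 1) \<le> 1"
    and i: "i < n"
  shows "x i = 0 \<and> s i = 0"
proof -
  note wD = stationaryD[OF w] and vD = stationaryD[OF v]
  define \<mu> where "\<mu> = l - 1"
  define N where "N = l1_norm n s"
  define \<beta> where "\<beta> = (\<Sum>i<n. s i)"
  define \<alpha> where "\<alpha> = (\<Sum>i<n. of_real (w i) * x i)"
  define p where "p = (\<Sum>i<n. of_real (w i) * s i)"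
  define t where "t = (\<Sum>i<n. w i * v i)"
  define h where "h = real n * \<epsilon> * q"
  have N0: "0 \<le> N" by (simp add: N_def l1_norm_def sum_nonneg)
  have wsum: "(\<Sum>i<n. complex_of_real (w i)) = 1" using wD(2) by (simp flip: of_real_sum)
  have vsum: "(\<Sum>i<n. complex_of_real (v i)) = 1" using vD(2) by (simp flip: of_real_sum)
  have wP: "(\<Sum>i<n. of_real (w i) * (\<Sum>j<n. of_real (P i j) * f j)) = (\<Sum>j<n. of_real (w j) * f j)" for f :: "nat \<Rightarrow> complex"
  proof -
    have "(\<Sum>i<n. of_real (w i) * (\<Sum>j<n. of_real (P i j) * f j)) = (\<Sum>i<n. \<Sum>j<n. of_real (w i * P i j) * f j)"
      by (simp add: sum_distrib_left mult.assoc)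
    also have "\<dots> = (\<Sum>j<n. of_real (\<Sum>i<n. w i * P i j) * f j)"
      unfolding of_real_sum sum_distrib_right by (rule sum.swap)
    also have "\<dots> = (\<Sum>j<n. of_real (w j) * f j)" by (intro sum.cong) (auto simp: wD(3))
    finally show ?thesis .
  qed
  \<comment> \<open>\<open>small\<close> reads 8 h q + 4 \<epsilon> q \<le> 1, and q \<ge> 6. All
    errors in X - 1 will be multiples of h.\<close>
  have h1: "h \<le> 1 / 48"
  proof -
    have hq: "8 * (h * q) + 4 * \<epsilon> * q \<le> 1" using small by (simp add: h_def algebra_simps)
    have "h \<ge> 0" using \<epsilon> q by (simp add: h_def)
    then have "h * 6 \<le> h * q" using q by (intro mult_left_mono)
    moreover have "0 \<le> 4 * \<epsilon> * q" using \<epsilon> q by simp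
    ultimately show ?thesis using hq by linarith
  qed
  have h0: "0 \<le> h" using \<epsilon> q by (simp add: h_def)
  \<comment> \<open>Pairing the first block row with the left fixed vector w removes P.\<close>
  have \<mu>\<alpha>: "\<mu> * \<alpha> = of_real \<epsilon> * p"
  proof -
    have "l * \<alpha> = (\<Sum>i<n. of_real (w i) * (l * x i))" by (simp add: \<alpha>_def sum_distrib_left mult_ac)
    also have "\<dots> = (\<Sum>i<n. of_real (w i) * (\<Sum>j<n. of_real (P i j) * x j) + of_real \<epsilon> * (of_real (w i) * s i))"
      by (intro sum.cong) (auto simp: e1 algebra_simps)
    also have "\<dots> = \<alpha> + of_real \<epsilon> * p"
      by (simp add: sum.distrib wP \<alpha>_def p_def flip: sum_distrib_left)
    finally show ?thesis by (simp add: \<mu>_def algebra_simps)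
  qed

  \<comment> \<open>Removing the w-mean makes \<open>Q\<close> applicable; the right-hand side
    becomes \<epsilon> (s_i - p), because \<mu> \<alpha> = \<epsilon> p.\<close>
  define y where "y = (\<lambda>i. x i - \<alpha>)"
  have Py: "(\<Sum>j<n. of_real (P i j) * y j) = (\<Sum>j<n. of_real (P i j) * x j) - \<alpha>" if "i < n" for i
  proof -
    have "(\<Sum>j<n. of_real (P i j) * y j) = (\<Sum>j<n. of_real (P i j) * x j) - of_real (\<Sum>j<n. P i j) * \<alpha>"
      unfolding of_real_sum sum_distrib_right by (simp add: y_def algebra_simps sum_subtractf)
    then show ?thesis using row_stochasticD(2)[OF P that] by simp
  qed
  have yb: "cmod (y i) \<le> q * (\<epsilon> * N)" if "i < n" for i
  proof (rule Q[OF _ _ that])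
    show "(\<Sum>i<n. of_real (w i) * y i) = 0"
      by (simp add: y_def right_diff_distrib sum_subtractf \<alpha>_def[symmetric] wsum flip: sum_distrib_right)
    fix i assume i: "i < n"
    have "l * y i - (\<Sum>j<n. of_real (P i j) * y j) = of_real \<epsilon> * s i - \<mu> * \<alpha>"
      unfolding Py[OF i] using e1[OF i] by (simp add: y_def \<mu>_def algebra_simps)
    also have "\<dots> = of_real \<epsilon> * (s i - p)" by (simp add: \<mu>\<alpha> right_diff_distrib)
    finally have "cmod (l * y i - (\<Sum>j<n. of_real (P i j) * y j)) = \<epsilon> * cmod (s i - p)"
      using \<epsilon> by (simp add: norm_mult)
    then show "cmod (l * y i - (\<Sum>j<n. of_real (P i j) * y j)) \<le> \<epsilon> * N"
      using deviation_le_l1_norm[OF wD(1,2) i, of s] \<epsilon> by (simp add: N_def p_def)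
  qed
  \<comment> \<open>Adding the block rows gives (l - S) s = - \<mu> x = c. The mean \<alpha> is not
    controlled yet, but \<open>c_eq\<close> writes c through y and s alone, which bounds c by a
    multiple of \<epsilon> N.\<close>
  define c where "c = (\<lambda>i. - \<mu> * x i)"
  have c_eq: "c i = y i - (\<Sum>j<n. of_real (P i j) * y j) - of_real \<epsilon> * s i" if "i < n" for i
    unfolding Py[OF that] using e1[OF that] by (simp add: y_def c_def \<mu>_def algebra_simps)
  have csum: "(\<Sum>i<n. c i) = \<mu> * \<beta>"
  proof -
    have "(\<Sum>i<n. x i) = - \<beta>" using e3 by (simp add: \<beta>_def eq_neg_iff_add_eq_0)
    then show ?thesis by (simp add: c_def sum_negf flip: sum_distrib_left)
  qed
  have cb: "(\<Sum>i<n. cmod (c i)) \<le> \<epsilon> * (2 * real n * q + 1) * N"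
  proof -
    have "(\<Sum>i<n. cmod (c i)) \<le> (\<Sum>i<n. 2 * (q * (\<epsilon> * N)) + \<epsilon> * cmod (s i))"
    proof (intro sum_mono)
      fix i assume "i \<in> {..<n}"
      then have i: "i < n" by simp
      have "cmod (\<Sum>j<n. of_real (P i j) * y j) \<le> (\<Sum>j<n. P i j * (q * (\<epsilon> * N)))"
        using yb row_stochasticD(1)[OF P i]
        by (intro order_trans[OF norm_sum] sum_mono) (auto simp: norm_mult intro: mult_left_mono)
      also have "\<dots> = q * (\<epsilon> * N)" using row_stochasticD(2)[OF P i] by (simp flip: sum_distrib_right)
      finally have a: "cmod (\<Sum>j<n. of_real (P i j) * y j) \<le> q * (\<epsilon> * N)" .
      have "cmod (c i) \<le> cmod (y i) + cmod (\<Sum>j<n. of_real (P i j) * y j) + cmod (of_real \<epsilon> * s i)"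
        unfolding c_eq[OF i] by (intro order_trans[OF norm_triangle_ineq4] add_right_mono norm_triangle_ineq4)
      also have "\<dots> \<le> q * (\<epsilon> * N) + q * (\<epsilon> * N) + \<epsilon> * cmod (s i)"
        using \<epsilon> by (intro add_mono a yb[OF i]) (simp add: norm_mult)
      finally show "cmod (c i) \<le> 2 * (q * (\<epsilon> * N)) + \<epsilon> * cmod (s i)" by linarith
    qed
    also have "\<dots> = real n * (2 * (q * (\<epsilon> * N))) + \<epsilon> * N"
      by (simp add: sum.distrib N_def l1_norm_def flip: sum_distrib_left)
    finally show ?thesis by (simp add: algebra_simps)
  qed
  \<comment> \<open>Subtracting \<beta> v leaves a vector of sum 0, on which F inverts l - S. As (l
    - S) v = \<mu> v and c sums to \<mu> \<beta>, the right-hand side is c projected along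
    v.\<close>
  define z where "z = (\<lambda>i. if i < n then s i - \<beta> * of_real (v i) else 0)"
  have zsum: "(\<Sum>i<n. z i) = 0"
    by (simp add: z_def sum_subtractf \<beta>_def[symmetric] vsum flip: sum_distrib_left)
  have Dz: "l * z i - mat_op n (\<lambda>i j. of_real (S i j)) z i = (if i < n then c i - (\<Sum>j<n. c j) * of_real (v i) else 0)" for i
  proof (cases "i < n")
    case True
    have "(\<Sum>j<n. of_real (S i j) * z j) = (\<Sum>j<n. of_real (S i j) * s j) - \<beta> * of_real (\<Sum>j<n. v j * S i j)"
      unfolding of_real_sum sum_distrib_left by (simp add: z_def algebra_simps sum_subtractf)
    then have Sz: "(\<Sum>j<n. of_real (S i j) * z j) = (\<Sum>j<n. of_real (S i j) * s j) - \<beta> * of_real (v i)"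
      using vD(3)[OF True] by simp
    show ?thesis using True e1[OF True] e2[OF True]
      by (simp add: mat_op_def Sz csum) (simp add: z_def c_def \<mu>_def algebra_simps)
  qed (simp add: z_def mat_op_def)
  have zF: "z = F (\<lambda>i. if i < n then c i - (\<Sum>j<n. c j) * of_real (v i) else 0)"
    using Finv[of z, OF _ zsum] by (simp add: Dz) (simp add: z_def)
  have zb: "l1_norm n z \<le> N / 2"
  proof -
    have "l1_norm n z \<le> q * (2 * (\<Sum>i<n. cmod (c i)))"
      unfolding zF using q by (intro order_trans[OF Fb] mult_left_mono l1_norm_rank_one_le[OF vD(1,2)]) auto
    also have "\<dots> \<le> q * (2 * (\<epsilon> * (2 * real n * q + 1) * N))" using cb q by (intro mult_left_mono) auto
    also have "\<dots> = (4 * \<epsilon> * q * (2 * real n * q + 1)) * (N / 2)" by simp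
    also have "\<dots> \<le> 1 * (N / 2)" using small N0 by (intro mult_right_mono) auto
    finally show ?thesis by simp
  qed
  \<comment> \<open>The remainder z carries at most half of the norm of s, so the part along v
    dominates and errors can be measured against |\<beta>|.\<close>
  have N\<beta>: "N \<le> 2 * cmod \<beta>"
  proof -
    have "N \<le> (\<Sum>i<n. cmod (z i) + cmod \<beta> * v i)"
      unfolding N_def l1_norm_def
    proof (intro sum_mono)
      fix i assume "i \<in> {..<n}"
      then have i: "i < n" by simp
      have "s i = z i + \<beta> * of_real (v i)" using i by (simp add: z_def)
      then have "cmod (s i) \<le> cmod (z i) + cmod (\<beta> * of_real (v i))" using norm_triangle_ineq by metis
      then show "cmod (s i) \<le> cmod (z i) + cmod \<beta> * v i" using vD(1)[OF i] by (simp add: norm_mult)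
    qed
    also have "\<dots> = l1_norm n z + cmod \<beta>"
      by (simp add: sum.distrib l1_norm_def vD(2) flip: sum_distrib_left)
    finally show ?thesis using zb by simp
  qed
  define Y where "Y = (\<Sum>i<n. y i)"
  have \<beta>Y: "\<beta> + Y = - (of_nat n * \<alpha>)"
    using e3 by (simp add: Y_def y_def sum_subtractf \<beta>_def algebra_simps)
  show ?thesis
  proof (cases "\<beta> = 0")
    \<comment> \<open>Without a part along v the estimates alone force N, then y, then \<alpha> to
      vanish.\<close>
    case True
    then have "N = 0" using N\<beta> N0 by simp
    then have "s i = 0" if "i < n" for i
      using that by (simp add: N_def l1_norm_def sum_nonneg_eq_0_iff)
    moreover have "y i = 0" if "i < n" for i using yb[OF that] \<open>N = 0\<close> by simp
    moreover from this have "Y = 0" by (simp add: Y_def)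
    then have "\<alpha> = 0" using \<beta>Y True n by simp
    ultimately show ?thesis using i by (simp add: y_def)
  next
    case False
    then have \<beta>pos: "cmod \<beta> > 0" by simp
    \<comment> \<open>Estimating z in norm would lose the factor t. Instead, x = \<alpha> + y and
      \<mu> \<alpha> = \<epsilon> p give c = - \<epsilon> p - \<mu> y, and \<open>d1\<close>,
      \<open>d2\<close> are the projections along v of the all-ones vector and of y. Each part of z
      then carries p or \<mu> as an explicit factor.\<close>
    define d1 where "d1 = (\<lambda>i. if i < n then 1 - (\<Sum>j<n. 1) * complex_of_real (v i) else 0)"
    define d2 where "d2 = (\<lambda>i. if i < n then y i - (\<Sum>j<n. y j) * complex_of_real (v i) else 0)"
    define \<rho>1 where "\<rho>1 = (\<Sum>i<n. of_real (w i) * F d1 i)"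
    define \<rho>2 where "\<rho>2 = (\<Sum>i<n. of_real (w i) * F d2 i)"
    have sumyb: "(\<Sum>i<n. cmod (y i)) \<le> h * N"
    proof -
      have "(\<Sum>i<n. cmod (y i)) \<le> (\<Sum>i<n. q * (\<epsilon> * N))" using yb by (intro sum_mono) auto
      then show ?thesis by (simp add: h_def algebra_simps)
    qed
    have \<rho>1b: "\<epsilon> * cmod \<rho>1 \<le> 2 * h"
    proof -
      have "cmod \<rho>1 \<le> q * (2 * (\<Sum>i<n. cmod 1))"
        unfolding \<rho>1_def d1_def using q
        by (intro order_trans[OF weighted_sum_le_l1_norm[OF wD(1,2)]] order_trans[OF Fb] mult_left_mono l1_norm_rank_one_le[OF vD(1,2)]) auto
      then show ?thesis using mult_left_mono[of "cmod \<rho>1" _ \<epsilon>] \<epsilon> by (fastforce simp: h_def algebra_simps)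
    qed
    have \<rho>2b: "cmod \<rho>2 \<le> q * (2 * (h * N))"
    proof -
      have "cmod \<rho>2 \<le> q * (2 * (\<Sum>i<n. cmod (y i)))"
        unfolding \<rho>2_def d2_def using q
        by (intro order_trans[OF weighted_sum_le_l1_norm[OF wD(1,2)]] order_trans[OF Fb] mult_left_mono l1_norm_rank_one_le[OF vD(1,2)]) auto
      also have "\<dots> \<le> q * (2 * (h * N))" using sumyb q by (intro mult_left_mono) auto
      finally show ?thesis .
    qed
    have D: "(\<lambda>i. if i < n then c i - (\<Sum>j<n. c j) * of_real (v i) else 0)
        = (\<lambda>i. (- of_real \<epsilon> * p) * d1 i + (- \<mu>) * d2 i)"
    proof
      fix i
      have "\<mu> * \<beta> = \<mu> * (\<beta> + Y) - \<mu> * Y" by (simp add: algebra_simps)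
      also have "\<dots> = - of_nat n * (\<mu> * \<alpha>) - \<mu> * Y" unfolding \<beta>Y by (simp add: algebra_simps)
      finally show "(if i < n then c i - (\<Sum>j<n. c j) * of_real (v i) else 0) = (- of_real \<epsilon> * p) * d1 i + (- \<mu>) * d2 i"
        by (simp add: d1_def d2_def csum flip: \<mu>\<alpha> Y_def) (simp add: c_def y_def algebra_simps)
    qed
    have zcomb: "z = (\<lambda>i. (- of_real \<epsilon> * p) * F d1 i + (- \<mu>) * F d2 i)"
      unfolding zF D by (rule lin_op_comb[OF F])
    \<comment> \<open>This is the w-mean of s = \<beta> v + z; t enters exactly, as the w-mean of
      v.\<close>
    have p_eq: "p * (1 + of_real \<epsilon> * \<rho>1) = \<beta> * of_real t - \<mu> * \<rho>2"
    proof -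
      have "p = (\<Sum>i<n. of_real (w i) * (\<beta> * of_real (v i) + z i))"
        unfolding p_def by (intro sum.cong) (auto simp: z_def)
      also have "\<dots> = \<beta> * of_real t + (\<Sum>i<n. of_real (w i) * z i)"
        unfolding t_def of_real_sum sum_distrib_left by (simp add: algebra_simps sum.distrib)
      also have "(\<Sum>i<n. of_real (w i) * z i) = - of_real \<epsilon> * p * \<rho>1 - \<mu> * \<rho>2"
        unfolding zcomb \<rho>1_def \<rho>2_def sum_distrib_left by (simp add: algebra_simps sum.distrib sum_subtractf sum_negf)
      finally show ?thesis by (simp add: algebra_simps)
    qed
    \<comment> \<open>Eliminating p between \<open>p_eq\<close> and \<mu> (\<beta> + Y) = - n
      \<epsilon> p, and moving every term with \<mu> to the left, leaves - n \<epsilon> \<beta> t on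
      the right. X is the factor of \<mu> after division by \<beta>.\<close>
    define X where "X = (1 + Y / \<beta>) * (1 + of_real \<epsilon> * \<rho>1) - of_real (real n * \<epsilon>) * \<rho>2 / \<beta>"
    have "\<mu> * (\<beta> + Y) = - of_nat n * of_real \<epsilon> * p"
      unfolding \<beta>Y using \<mu>\<alpha> by (simp add: algebra_simps)
    then have eq: "\<mu> * (\<beta> + Y) * (1 + of_real \<epsilon> * \<rho>1) = - of_nat n * of_real \<epsilon> * (\<beta> * of_real t - \<mu> * \<rho>2)"
      using p_eq by (metis mult.assoc)
    have \<beta>X: "\<beta> * X = (\<beta> + Y) * (1 + of_real \<epsilon> * \<rho>1) - of_real (real n * \<epsilon>) * \<rho>2"
      using False by (simp add: X_def field_simps)
    have "\<beta> * (\<mu> * X) = \<mu> * (\<beta> * X)" by simp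
    also have "\<dots> = \<mu> * (\<beta> + Y) * (1 + of_real \<epsilon> * \<rho>1) - \<mu> * (of_real (real n * \<epsilon>) * \<rho>2)"
      by (simp only: \<beta>X right_diff_distrib mult.assoc)
    also have "\<dots> = \<beta> * (- of_real (real n * \<epsilon> * t))"
      unfolding eq by (simp add: algebra_simps)
    finally have main: "\<mu> * X = - of_real (real n * \<epsilon> * t)"
      using False unfolding mult_cancel_left by blast
    have Yb: "cmod (Y / \<beta>) \<le> 2 * h"
    proof -
      have "cmod Y \<le> h * N" unfolding Y_def by (rule order_trans[OF norm_sum sumyb])
      also have "\<dots> \<le> h * (2 * cmod \<beta>)" using N\<beta> h0 by (intro mult_left_mono)
      finally show ?thesis using \<beta>pos by (simp add: norm_divide field_simps)
    qed
    have Zb: "cmod (of_real (real n * \<epsilon>) * \<rho>2 / \<beta>) \<le> 4 * h * h"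
    proof -
      have "real n * \<epsilon> * cmod \<rho>2 \<le> real n * \<epsilon> * (q * (2 * (h * (2 * cmod \<beta>))))"
        using \<epsilon> q h0 N\<beta> by (intro mult_left_mono order_trans[OF \<rho>2b]) auto
      also have "\<dots> = 4 * h * h * cmod \<beta>" by (simp add: h_def)
      finally show ?thesis using \<beta>pos \<epsilon> by (simp add: norm_divide norm_mult field_simps)
    qed
    have "X - 1 = Y / \<beta> + of_real \<epsilon> * \<rho>1 + Y / \<beta> * (of_real \<epsilon> * \<rho>1) - of_real (real n * \<epsilon>) * \<rho>2 / \<beta>"
      by (simp add: X_def algebra_simps)
    then have "cmod (X - 1) \<le> cmod (Y / \<beta>) + cmod (of_real \<epsilon> * \<rho>1) + cmod (Y / \<beta> * (of_real \<epsilon> * \<rho>1))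
        + cmod (of_real (real n * \<epsilon>) * \<rho>2 / \<beta>)"
      by (simp only:) (intro order_trans[OF norm_triangle_ineq4] add_mono order_trans[OF norm_triangle_ineq] order_refl)
    also have "\<dots> \<le> 2 * h + 2 * h + 2 * h * (2 * h) + 4 * h * h"
    proof (intro add_mono Yb Zb)
      show r: "cmod (of_real \<epsilon> * \<rho>1) \<le> 2 * h" using \<rho>1b \<epsilon> by (simp add: norm_mult)
      show "cmod (Y / \<beta> * (of_real \<epsilon> * \<rho>1)) \<le> 2 * h * (2 * h)"
        unfolding norm_mult[of "Y / \<beta>"] using Yb r h0 by (intro mult_mono) auto
    qed
    also have "\<dots> = 4 * h + 8 * h * h" by simp
    also have "\<dots> \<le> 4 * h + 8 * h * 1" using h0 h1 by (intro add_mono mult_left_mono) auto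
    also have "\<dots> \<le> 1 / 2" using h1 by simp
    finally have "1 / 2 \<le> Re X" using Re_ge_of_norm_diff_le[of X "1 / 2"] by simp
    moreover have "0 < real n * \<epsilon> * t" using n \<epsilon> t by (simp add: t_def)
    moreover have "real n * \<epsilon> * t < 1"
    proof -
      have v1: "v i \<le> 1" if "i < n" for i
        using member_le_sum[of i "{..<n}" v] vD that by auto
      have "t \<le> (\<Sum>i<n. w i * 1)" unfolding t_def using wD(1) v1 by (intro sum_mono mult_left_mono) auto
      then have "t \<le> 1" using wD(2) by simp
      then have "real n * \<epsilon> * t \<le> real n * \<epsilon> * q" using q \<epsilon> by (intro mult_left_mono) auto
      then show ?thesis using h1 by (simp add: h_def)
    qed
    ultimately have "cmod (1 + \<mu>) < 1" using perturbed_eigenvalue_inside[OF main] by blast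
    then show ?thesis using l by (simp add: \<mu>_def)
  qed
qed

section \<open>Spectrum and convergence\<close>

text \<open>For \<rho> strictly between the spectral radius and 1, the matrix B = A / \<rho> still
  has spectral radius below 1, so its powers are bounded and those of A decay like \<rho>^k.\<close>

lemma powers_tendsto_0:
  fixes A :: "complex mat"
  assumes A: "A \<in> carrier_mat d d" and ev: "\<And>z. eigenvalue A z \<Longrightarrow> cmod z < 1"
    and ij: "i < d" "j < d"
  shows "(\<lambda>k. (A ^\<^sub>m k) $$ (i, j)) \<longlonglongrightarrow> 0"
proof -
  have d: "d > 0" using ij by simp
  define \<rho> where "\<rho> = (1 + spectral_radius A) / 2"
  obtain z where z: "z \<in> spectrum A" "spectral_radius A = cmod z"
    using spectral_radius_mem_max(1)[OF A d] by auto
  then have "spectral_radius A < 1" "0 \<le> spectral_radius A" using ev by (auto simp: spectrum_def)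
  then have \<rho>: "0 < \<rho>" "\<rho> < 1" "spectral_radius A < \<rho>" by (auto simp: \<rho>_def)
  define B where "B = complex_of_real (inverse \<rho>) \<cdot>\<^sub>m A"
  have B: "B \<in> carrier_mat d d" using A by (simp add: B_def)
  have AB: "A = complex_of_real \<rho> \<cdot>\<^sub>m B" using \<rho>(1) by (intro eq_matI) (auto simp: B_def)
  have "cmod y < 1" if "eigenvalue B y" for y
  proof -
    from that obtain u where u: "u \<in> carrier_vec d" "u \<noteq> 0\<^sub>v d" "B *\<^sub>v u = y \<cdot>\<^sub>v u"
      using B by (auto simp: eigenvalue_def eigenvector_def)
    have "A *\<^sub>v u = complex_of_real \<rho> \<cdot>\<^sub>v (B *\<^sub>v u)"
      unfolding AB using B u(1) by (intro eq_vecI) auto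
    then have "A *\<^sub>v u = (complex_of_real \<rho> * y) \<cdot>\<^sub>v u" by (simp add: u(3) smult_smult_assoc)
    then have "eigenvalue A (complex_of_real \<rho> * y)"
      using A u by (auto simp: eigenvalue_def eigenvector_def intro!: exI[of _ u])
    then have "cmod (complex_of_real \<rho> * y) \<le> spectral_radius A"
      by (intro spectral_radius_mem_max(2)[OF A d]) (auto simp: spectrum_def)
    then have "\<rho> * cmod y \<le> spectral_radius A" using \<rho>(1) by (simp add: norm_mult)
    then have "\<rho> * cmod y < \<rho> * 1" using \<rho>(3) by linarith
    then show ?thesis using \<rho>(1) by (simp only: mult_less_cancel_left_pos)
  qed
  moreover obtain y where "y \<in> spectrum B" "spectral_radius B = cmod y"
    using spectral_radius_mem_max(1)[OF B d] by auto
  ultimately have "spectral_radius B < 1" by (auto simp: spectrum_def)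
  from spectral_radius_jnf_norm_bound_less_1_upper_triangular[OF B this]
  obtain c where c: "\<And>k. norm_bound (B ^\<^sub>m k) c" by auto
  have pow: "A ^\<^sub>m k = complex_of_real (\<rho> ^ k) \<cdot>\<^sub>m (B ^\<^sub>m k)" for k
  proof (induction k)
    case 0
    show ?case using A B by (intro eq_matI) auto
  next
    case (Suc k)
    have "A ^\<^sub>m Suc k = (complex_of_real (\<rho> ^ k) \<cdot>\<^sub>m (B ^\<^sub>m k)) * (complex_of_real \<rho> \<cdot>\<^sub>m B)"
      using Suc.IH AB by simp
    also have "\<dots> = complex_of_real (\<rho> ^ k) \<cdot>\<^sub>m (complex_of_real \<rho> \<cdot>\<^sub>m (B ^\<^sub>m k * B))"
      using B by (subst mult_smult_assoc_mat[of _ d d _ d]) (auto simp: mult_smult_distrib[of _ d d _ d])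
    also have "\<dots> = complex_of_real (\<rho> ^ Suc k) \<cdot>\<^sub>m (B ^\<^sub>m Suc k)"
      using B by (intro eq_matI) (auto simp: mult_ac)
    finally show ?case .
  qed
  have bound: "cmod ((A ^\<^sub>m k) $$ (i, j)) \<le> \<rho> ^ k * c" for k
  proof -
    have "(A ^\<^sub>m k) $$ (i, j) = complex_of_real (\<rho> ^ k) * (B ^\<^sub>m k) $$ (i, j)"
      unfolding pow using B ij by (subst index_smult_mat) auto
    then have "cmod ((A ^\<^sub>m k) $$ (i, j)) = \<rho> ^ k * cmod ((B ^\<^sub>m k) $$ (i, j))"
      using \<rho>(1) by (simp add: norm_mult norm_power)
    also have "\<dots> \<le> \<rho> ^ k * c"
      using c[of k] B ij \<rho>(1) unfolding norm_bound_def by (intro mult_left_mono) auto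
    finally show ?thesis .
  qed
  have "(\<lambda>k. \<rho> ^ k * c) \<longlonglongrightarrow> 0 * c"
    using \<rho> by (intro tendsto_mult_right LIMSEQ_realpow_zero) auto
  then have "(\<lambda>k. \<rho> ^ k * c) \<longlonglongrightarrow> 0" by simp
  then have "(\<lambda>k. cmod ((A ^\<^sub>m k) $$ (i, j))) \<longlonglongrightarrow> 0"
    by (rule tendsto_sandwich[OF _ _ tendsto_const, rotated 2])
      (intro always_eventually allI norm_ge_zero bound)+
  then show ?thesis by (rule tendsto_norm_zero_cancel)
qed

lemma char_poly_split_off_1:
  assumes A: "(A :: complex mat) \<in> carrier_mat n n" and ev: "eigenvalue A 1"
  obtains as where "char_poly A = [:-1, 1:] * (\<Prod>a\<leftarrow>as. [:-a, 1:])" "length as = n - 1"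
proof -
  obtain bs where bs: "char_poly A = (\<Prod>a\<leftarrow>bs. [:-a, 1:])" "length bs = n"
    using char_poly_factorized[OF A] by auto
  have "poly (\<Prod>a\<leftarrow>bs. [:-a, 1:]) 1 = 0" using ev eigenvalue_root_char_poly[OF A] bs by simp
  then have "1 \<in> set bs" by (auto simp: poly_prod_list prod_list_zero_iff)
  then show ?thesis
    using that[of "remove1 1 bs"] bs prod_list_map_remove1[of 1 bs "\<lambda>a. [:-a, 1:]"]
    by (simp add: length_remove1)
qed

text \<open>The characteristic polynomial is the product of those of the diagonal blocks, and each
  has the root 1. Splitting off one copy from each accounts for the two copies that
  \<open>r_rem\<close> removes, so \<open>as\<close> and \<open>bs\<close> list the remaining
  eigenvalues.\<close>

lemma r_rem_block_triangular:
  fixes P S :: "nat \<Rightarrow> nat \<Rightarrow> real"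
  assumes n: "n > 1" and P: "row_stochastic n P" and S: "row_stochastic n (\<lambda>i j. S j i)"
    and C: "C \<in> carrier_mat n n"
  defines "r \<equiv> r_rem (four_block_mat (mat n n (\<lambda>(i, j). P i j)) (0\<^sub>m n n) C (mat n n (\<lambda>(i, j). S i j)))"
  obtains as bs where
    "char_poly (mat n n (\<lambda>(i, j). complex_of_real (P i j))) = [:-1, 1:] * (\<Prod>a\<leftarrow>as. [:-a, 1:])"
    "char_poly (mat n n (\<lambda>(i, j). complex_of_real (S i j))) = [:-1, 1:] * (\<Prod>a\<leftarrow>bs. [:-a, 1:])"
    "length as = n - 1" "length bs = n - 1" "\<And>a. a \<in> set as \<union> set bs \<Longrightarrow> cmod a \<le> r" "0 \<le> r" "r \<le> 1"
proof -
  define A where "A = mat n n (\<lambda>(i, j). complex_of_real (P i j))"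
  define B where "B = mat n n (\<lambda>(i, j). complex_of_real (S i j))"
  have A: "A \<in> carrier_mat n n" and B: "B \<in> carrier_mat n n" by (simp_all add: A_def B_def)
  have AT: "A = transpose_mat (mat n n (\<lambda>(i, j). complex_of_real (P j i)))"
    by (auto simp: A_def intro!: eq_matI)
  have BT: "B = transpose_mat (mat n n (\<lambda>(i, j). complex_of_real (S j i)))"
    by (auto simp: B_def intro!: eq_matI)
  have n0: "n > 0" using n by simp
  have evA: "eigenvalue A 1" unfolding A_def by (rule stochastic_eigenvalue_1[OF P n0])
  have "eigenvalue (mat n n (\<lambda>(i, j). complex_of_real (S j i))) 1"
    by (rule stochastic_eigenvalue_1[OF S n0])
  then have evB: "eigenvalue B 1"
    unfolding eigenvalue_root_char_poly[OF B] eigenvalue_root_char_poly[of "mat n n (\<lambda>(i, j). complex_of_real (S j i))" n, OF mat_carrier]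
    by (subst BT) (simp add: char_poly_transpose_mat[of _ n])
  obtain as where as: "char_poly A = [:-1, 1:] * (\<Prod>a\<leftarrow>as. [:-a, 1:])" "length as = n - 1"
    using char_poly_split_off_1[OF A evA] .
  obtain bs where bs: "char_poly B = [:-1, 1:] * (\<Prod>a\<leftarrow>bs. [:-a, 1:])" "length bs = n - 1"
    using char_poly_split_off_1[OF B evB] .
  define f where "f = (\<Prod>a\<leftarrow>as. [:-a, 1:]) * (\<Prod>a\<leftarrow>bs. [:-a, 1:])"
  define p where "p = char_poly (map_mat complex_of_real
    (four_block_mat (mat n n (\<lambda>(i, j). P i j)) (0\<^sub>m n n) C (mat n n (\<lambda>(i, j). S i j))))"
  have "map_mat complex_of_real (four_block_mat (mat n n (\<lambda>(i, j). P i j)) (0\<^sub>m n n) C (mat n n (\<lambda>(i, j). S i j)))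
      = four_block_mat A (0\<^sub>m n n) (map_mat complex_of_real C) B"
    using C by (subst map_four_block_mat[of _ n n _ n _ n]) (auto simp: A_def B_def intro!: arg_cong2[where f = "\<lambda>x y. four_block_mat x _ _ y"] eq_matI)
  then have p: "p = char_poly A * char_poly B"
    unfolding p_def using char_poly_factorized[OF A] char_poly_factorized[OF B] C A B
    by (intro char_poly_0_block'[where C = "map_mat complex_of_real C" and n = n and m = n]) auto
  have pf: "p = [:-1, 1:] ^ 2 * f"
    by (simp only: p as bs f_def power2_eq_square mult_ac)
  have p0: "p \<noteq> 0" using p degree_monic_char_poly[OF A] degree_monic_char_poly[OF B] by auto
  define R where "R = {cmod z | z. poly p z = 0 \<and> z \<noteq> 1} \<union> (if order 1 p \<ge> 3 then {1} else {})"
  have r: "r = Max R" by (simp add: r_def r_rem_def R_def p_def Let_def)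
  have fin: "finite R"
  proof -
    have "finite (cmod ` {z. poly p z = 0})" using poly_roots_finite[OF p0] by simp
    moreover have "{cmod z | z. poly p z = 0 \<and> z \<noteq> 1} \<subseteq> cmod ` {z. poly p z = 0}" by auto
    ultimately show ?thesis by (auto simp: R_def intro: finite_subset)
  qed
  have mem: "cmod a \<in> R" if a: "a \<in> set as \<union> set bs" for a
  proof -
    have root: "poly f a = 0" using a by (auto simp: f_def poly_prod_list prod_list_zero_iff)
    show ?thesis
    proof (cases "a = 1")
      \<comment> \<open>A further root 1 raises the order of 1 to at least 3, the case in which
        \<open>r_rem\<close> inserts the value 1.\<close>
      case True
      then have "[:-1, 1:] dvd f" using root by (simp add: poly_eq_0_iff_dvd)
      then have "[:-1, 1:] ^ 3 dvd p"
        unfolding pf power3_eq_cube power2_eq_square by (rule mult_dvd_mono[OF dvd_refl])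
      then have "3 \<le> order 1 p" using p0 by (simp add: order_divides)
      then show ?thesis using True by (simp add: R_def)
    next
      case False
      then show ?thesis using root by (auto simp: R_def pf)
    qed
  qed
  have le: "cmod a \<le> r" if "a \<in> set as \<union> set bs" for a
    unfolding r using fin mem[OF that] by (rule Max_ge)
  \<comment> \<open>As n > 1, some eigenvalue remains after the removal: \<open>R\<close> is
    nonempty, and r, bounding a modulus, is nonnegative.\<close>
  obtain a where "a \<in> set as" using as(2) n by (cases as) auto
  then have "0 \<le> r" "R \<noteq> {}"
    using order_trans[OF norm_ge_zero le[of a]] mem[of a] by auto
  moreover have "x \<le> 1" if "x \<in> R" for x
  proof -
    have "cmod z \<le> 1" if "poly p z = 0" for z
    proof -
      have "poly (char_poly A) z = 0 \<or> poly (char_poly B) z = 0" using that by (simp add: p)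
      then show ?thesis
      proof
        assume "poly (char_poly A) z = 0"
        then have "poly (char_poly (mat n n (\<lambda>(i, j). complex_of_real (P j i)))) z = 0"
          by (simp add: AT char_poly_transpose_mat[of _ n])
        then show ?thesis by (rule stochastic_root_le_1[OF P])
      next
        assume "poly (char_poly B) z = 0"
        then show ?thesis unfolding B_def by (rule stochastic_root_le_1[OF S])
      qed
    qed
    then show ?thesis using that by (auto simp: R_def split: if_splits)
  qed
  ultimately have "r \<le> 1" unfolding r using fin by simp
  show ?thesis
    by (rule that[of as bs]) (use as bs le \<open>0 \<le> r\<close> \<open>r \<le> 1\<close> in \<open>auto simp: A_def B_def\<close>)
qed

section \<open>Numerical estimates behind the threshold\<close>

text \<open>From r = 1 - (1 - r) \<le> exp(-(1 - r)) follows r^m \<le> exp(-1) \<le> 1/2.\<close>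

lemma power_le_half:
  fixes r :: real
  assumes "0 \<le> r" "1 / (1 - r) \<le> real m" "r < 1"
  shows "r ^ m \<le> 1 / 2"
proof -
  have "r \<le> exp (- (1 - r))" using exp_ge_add_one_self[of "- (1 - r)"] by simp
  then have "r ^ m \<le> exp (- (1 - r)) ^ m" using assms(1) by (rule power_mono)
  also have "\<dots> = exp (- ((1 - r) * real m))" by (simp add: exp_of_nat_mult[symmetric] algebra_simps)
  also have "\<dots> \<le> exp (- 1)" using assms(2,3) by (simp add: field_simps)
  also have "\<dots> \<le> 1 / 2" using exp_ge_add_one_self[of 1] by (simp add: exp_minus field_simps)
  finally show ?thesis .
qed

text \<open>In the splitting 36 = 4 * 9 the powers of 4 absorb the linear factor.\<close>

lemma linear_times_power9_le_power36:
  assumes "k \<ge> 1"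
  shows "32 * (real k + 1) * 9 ^ k + 8 * 3 ^ k \<le> 36 * 36 ^ k"
proof -
  have a: "32 * real k + 40 \<le> 36 * 4 ^ k"
    using assms by (induction k rule: nat_induct_at_least) auto
  have "8 * (3::real) ^ k \<le> 8 * 9 ^ k" by (simp add: power_mono)
  then have "32 * (real k + 1) * 9 ^ k + 8 * 3 ^ k \<le> (32 * real k + 40) * 9 ^ k" by (simp add: algebra_simps)
  also have "\<dots> \<le> (36 * 4 ^ k) * 9 ^ k" using a by (intro mult_right_mono) auto
  also have "\<dots> = 36 * (4 * 9) ^ k" by (simp only: power_mult_distrib mult.assoc)
  finally show ?thesis by simp
qed

text \<open>As n \<ge> 2, 20 + 8 n \<ge> 36 and \<delta>^n \<le> \<delta>^2, so \<epsilon> \<le>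
  \<delta>^2 / 36^n. The claim is quadratic in q, and q \<delta> = 2 * 3^(n-1) is free of \<delta>,
  so two powers of \<delta> suffice; what is left is the preceding inequality with k = n -
  1.\<close>

lemma small_parameter:
  fixes \<epsilon> \<delta> :: real
  assumes n: "n > 1" and \<delta>: "0 < \<delta>" "\<delta> \<le> 1" and \<epsilon>: "0 < \<epsilon>" "\<epsilon> < \<delta> ^ n / (20 + 8 * real n) ^ n"
  defines "q \<equiv> 2 / \<delta> * 3 ^ (n - 1)"
  shows "4 * \<epsilon> * q * (2 * real n * q + 1) \<le> 1"
proof -
  obtain k where k: "n = Suc k" "k \<ge> 1" using n by (cases n) auto
  have "\<epsilon> \<le> \<delta> ^ n / 36 ^ n"
  proof -
    have "(36::real) ^ n \<le> (20 + 8 * real n) ^ n" using n by (intro power_mono) auto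
    then have "\<delta> ^ n / (20 + 8 * real n) ^ n \<le> \<delta> ^ n / 36 ^ n" using \<delta> by (intro divide_left_mono) auto
    then show ?thesis using \<epsilon> by simp
  qed
  also have "\<dots> \<le> \<delta>\<^sup>2 / 36 ^ n" using n \<delta> power_decreasing[of 2 n \<delta>] by (intro divide_right_mono) auto
  finally have e: "\<epsilon> * 36 ^ n \<le> \<delta>\<^sup>2" by (simp add: field_simps)
  have q1: "q * \<delta> = 2 * 3 ^ k" using \<delta> by (simp add: q_def k)
  have "\<delta>\<^sup>2 * (4 * q * (2 * real n * q + 1)) = 8 * real n * (q * \<delta>)\<^sup>2 + 4 * (q * \<delta>) * \<delta>"
    by (simp add: power2_eq_square algebra_simps)
  also have "\<dots> \<le> 8 * real n * (q * \<delta>)\<^sup>2 + 4 * (q * \<delta>) * 1"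
    unfolding q1 using \<delta> by (intro add_left_mono mult_left_mono) auto
  also have "\<dots> = 32 * (real k + 1) * 9 ^ k + 8 * 3 ^ k"
    unfolding q1 by (simp add: k power_mult_distrib power2_eq_square algebra_simps flip: power_mult_distrib)
  also have "\<dots> \<le> 36 ^ n" using linear_times_power9_le_power36[OF k(2)] by (simp add: k)
  finally have s: "\<delta>\<^sup>2 * (4 * q * (2 * real n * q + 1)) \<le> 36 ^ n" .
  have "4 * q * (2 * real n * q + 1) \<le> 36 ^ n / \<delta>\<^sup>2" using s \<delta> by (simp add: field_simps)
  then have "\<epsilon> * (4 * q * (2 * real n * q + 1)) \<le> \<epsilon> * (36 ^ n / \<delta>\<^sup>2)" using \<epsilon> by (intro mult_left_mono) auto
  also have "\<dots> \<le> 1" using e \<delta> by (simp add: field_simps)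
  finally show ?thesis by (simp add: algebra_simps)
qed

section \<open>From the spectrum to average consensus\<close>

lemma sum_lessThan_add: "(\<Sum>j<n + m. f j) = (\<Sum>j<n. f j) + (\<Sum>j<m. f (n + j))"
  for f :: "nat \<Rightarrow> 'a :: comm_monoid_add"
  by (induction m) (simp_all add: add.assoc)

text \<open>\<open>col\<close> makes the sum of all entries invariant, and \<open>row\<close> makes
  the vector with blocks 1 and 0 fixed. Subtracting the corresponding rank one projection from M
  removes the eigenvalue 1; \<open>ev\<close> puts the spectrum of the difference N inside the open
  unit disc, so the powers of N tend to 0.\<close>

lemma average_consensusI:
  fixes M :: "real mat"
  assumes n: "n > 0" and M: "M \<in> carrier_mat (2 * n) (2 * n)"
    and col: "\<And>j. j < 2 * n \<Longrightarrow> (\<Sum>i<2 * n. M $$ (i, j)) = 1"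
    and row: "\<And>i. i < 2 * n \<Longrightarrow> (\<Sum>j<n. M $$ (i, j)) = (if i < n then 1 else 0)"
    and ev: "\<And>z y i. cmod z \<ge> 1 \<Longrightarrow>
      (\<And>i. i < 2 * n \<Longrightarrow> (\<Sum>j<2 * n. complex_of_real (M $$ (i, j)) * y j) = z * y i) \<Longrightarrow>
      (\<Sum>j<2 * n. y j) = 0 \<Longrightarrow> i < 2 * n \<Longrightarrow> y i = 0"
  shows "average_consensus n M"
  unfolding average_consensus_def
proof (intro allI impI)
  fix x0 :: "nat \<Rightarrow> real" and i assume i: "i < 2 * n"
  define g where "g = (\<lambda>i. if i < n then 1 / real n else 0)"
  define N where "N = mat (2 * n) (2 * n) (\<lambda>(i, j). M $$ (i, j) - g i)"
  have N: "N \<in> carrier_mat (2 * n) (2 * n)" by (simp add: N_def)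
  have half: "(\<Sum>j<2 * n. (if j < n then f j else 0)) = (\<Sum>j<n. f j)" for f :: "nat \<Rightarrow> real"
    by (simp add: mult_2 sum_lessThan_add)
  have gsum: "(\<Sum>i<2 * n. g i) = 1" using n unfolding g_def half by simp
  have Mv: "(M *\<^sub>v d) $ i = (\<Sum>j<2 * n. M $$ (i, j) * d $ j)" if "d \<in> carrier_vec (2 * n)" "i < 2 * n" for d i
    using that M by (simp add: scalar_prod_def atLeast0LessThan)
  have Nv: "(N *\<^sub>v d) $ i = (\<Sum>j<2 * n. M $$ (i, j) * d $ j) - g i * (\<Sum>j<2 * n. d $ j)"
    if "d \<in> carrier_vec (2 * n)" "i < 2 * n" for d i
  proof -
    have "(N *\<^sub>v d) $ i = (\<Sum>j<2 * n. (M $$ (i, j) - g i) * d $ j)"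
      using that by (simp add: N_def scalar_prod_def atLeast0LessThan)
    then show ?thesis by (simp add: left_diff_distrib sum_subtractf sum_distrib_left)
  qed
  have "cmod z < 1" if "eigenvalue (map_mat complex_of_real N) z" for z
  proof (rule ccontr)
    assume z: "\<not> cmod z < 1"
    from that obtain y where y: "y \<in> carrier_vec (2 * n)" "y \<noteq> 0\<^sub>v (2 * n)"
      "map_mat complex_of_real N *\<^sub>v y = z \<cdot>\<^sub>v y"
      using N by (auto simp: eigenvalue_def eigenvector_def)
    define Y where "Y = (\<Sum>j<2 * n. y $ j)"
    have e: "(\<Sum>j<2 * n. complex_of_real (M $$ (i, j)) * y $ j) - of_real (g i) * Y = z * y $ i" if "i < 2 * n" for i
    proof -
      have "(map_mat complex_of_real N *\<^sub>v y) $ i = (\<Sum>j<2 * n. of_real (M $$ (i, j) - g i) * y $ j)"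
        using that y(1) by (simp add: N_def scalar_prod_def atLeast0LessThan)
      also have "\<dots> = (\<Sum>j<2 * n. complex_of_real (M $$ (i, j)) * y $ j) - of_real (g i) * Y"
        by (simp add: left_diff_distrib sum_subtractf Y_def flip: sum_distrib_left)
      finally show ?thesis using y that by simp
    qed
    \<comment> \<open>Both M and the projection preserve totals, so z Y = Y - Y = 0. An eigenvector
      of N for z therefore has sum 0 and is one of M, which \<open>ev\<close> excludes.\<close>
    have "z * Y = (\<Sum>i<2 * n. (\<Sum>j<2 * n. complex_of_real (M $$ (i, j)) * y $ j) - of_real (g i) * Y)"
      unfolding Y_def sum_distrib_left by (intro sum.cong) (simp_all add: e[unfolded Y_def] flip: sum_distrib_left)
    also have "\<dots> = (\<Sum>j<2 * n. of_real (\<Sum>i<2 * n. M $$ (i, j)) * y $ j) - of_real (\<Sum>i<2 * n. g i) * Y"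
      unfolding sum_subtractf of_real_sum sum_distrib_right by (subst sum.swap) simp
    also have "\<dots> = 0" by (simp add: col gsum Y_def)
    finally have "Y = 0" using z by auto
    then have "y $ i = 0" if "i < 2 * n" for i
      using e z that by (intro ev[of z "($) y"]) (auto simp: Y_def)
    then have "y = 0\<^sub>v (2 * n)" using y(1) by (intro eq_vecI) auto
    then show False using y(2) by simp
  qed
  then have lim: "(\<lambda>k. (N ^\<^sub>m k) $$ (i, j)) \<longlonglongrightarrow> 0" if "i < 2 * n" "j < 2 * n" for i j
  proof -
    have "(\<lambda>k. (map_mat complex_of_real N ^\<^sub>m k) $$ (i, j)) \<longlonglongrightarrow> 0"
      using \<open>\<And>z. eigenvalue (map_mat complex_of_real N) z \<Longrightarrow> cmod z < 1\<close> N that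
      by (intro powers_tendsto_0[of _ "2 * n"]) auto
    moreover have "(map_mat complex_of_real N ^\<^sub>m k) $$ (i, j) = of_real ((N ^\<^sub>m k) $$ (i, j))" for k
      using N that by (simp flip: of_real_hom.mat_hom_pow[OF N])
    ultimately show ?thesis using tendsto_of_real_iff[of "\<lambda>k. (N ^\<^sub>m k) $$ (i, j)" 0 sequentially, where 'a = complex] by simp
  qed
  \<comment> \<open>The initial state splits as c + d, where c is the claimed limit and fixed by M,
    and d has sum 0; M and N agree on vectors of sum 0, and M preserves that subspace.\<close>
  define xa where "xa = (\<Sum>j<n. x0 j) / real n"
  define c where "c = vec (2 * n) (\<lambda>i. if i < n then xa else 0)"
  define u where "u = vec (2 * n) (\<lambda>i. if i < n then x0 i else 0)"
  define d where "d = vec (2 * n) (\<lambda>i. if i < n then x0 i - xa else 0)"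
  have carr: "c \<in> carrier_vec (2 * n)" "u \<in> carrier_vec (2 * n)" "d \<in> carrier_vec (2 * n)"
    by (simp_all add: c_def u_def d_def)
  have u: "u = c + d" by (auto simp: c_def u_def d_def)
  have dsum: "(\<Sum>j<2 * n. d $ j) = 0"
  proof -
    have "(\<Sum>j<2 * n. d $ j) = (\<Sum>j<2 * n. if j < n then x0 j - xa else 0)"
      by (intro sum.cong) (auto simp: d_def)
    also have "\<dots> = 0" using n by (simp add: half sum_subtractf xa_def)
    finally show ?thesis .
  qed
  have Mc: "M *\<^sub>v c = c"
  proof (rule eq_vecI)
    fix i assume "i < dim_vec c"
    then have i: "i < 2 * n" by (simp add: c_def)
    have "(M *\<^sub>v c) $ i = (\<Sum>j<2 * n. if j < n then M $$ (i, j) * xa else 0)"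
      unfolding Mv[OF carr(1) i] by (intro sum.cong) (auto simp: c_def)
    also have "\<dots> = (\<Sum>j<n. M $$ (i, j)) * xa" unfolding half by (simp add: sum_distrib_right)
    also have "\<dots> = c $ i" using i by (simp add: row c_def)
    finally show "(M *\<^sub>v c) $ i = c $ i" .
  qed (use M carr in simp)
  have powc: "(M ^\<^sub>m k) *\<^sub>v c = c" for k
    by (induction k) (use M carr(1) Mc in \<open>auto simp: assoc_mult_mat_vec[of _ "2 * n" "2 * n" _ "2 * n"]\<close>)
  have powd: "(M ^\<^sub>m k) *\<^sub>v d = (N ^\<^sub>m k) *\<^sub>v d" if "d \<in> carrier_vec (2 * n)" "(\<Sum>j<2 * n. d $ j) = 0" for k d
    using that
  proof (induction k arbitrary: d)
    case 0
    then show ?case using M N by simp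
  next
    case (Suc k)
    have eq: "M *\<^sub>v d = N *\<^sub>v d"
      using M N Suc.prems by (intro eq_vecI) (simp_all add: Mv Nv del: index_mult_mat_vec)
    have "(\<Sum>i<2 * n. (M *\<^sub>v d) $ i) = (\<Sum>i<2 * n. \<Sum>j<2 * n. M $$ (i, j) * d $ j)"
      by (intro sum.cong) (auto simp: Mv[OF Suc.prems(1)])
    also have "\<dots> = (\<Sum>j<2 * n. (\<Sum>i<2 * n. M $$ (i, j)) * d $ j)"
      unfolding sum_distrib_right by (rule sum.swap)
    also have "\<dots> = 0" using Suc.prems(2) by (simp add: col)
    finally have s: "(\<Sum>i<2 * n. (M *\<^sub>v d) $ i) = 0" .
    have "(M ^\<^sub>m Suc k) *\<^sub>v d = (M ^\<^sub>m k) *\<^sub>v (M *\<^sub>v d)"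
      using M Suc.prems(1) by (simp add: assoc_mult_mat_vec[of _ "2 * n" "2 * n" _ "2 * n"])
    also have "\<dots> = (N ^\<^sub>m k) *\<^sub>v (M *\<^sub>v d)"
      using M Suc.prems(1) s by (intro Suc.IH) auto
    also have "\<dots> = (N ^\<^sub>m Suc k) *\<^sub>v d"
      unfolding eq using N Suc.prems(1) by (simp add: assoc_mult_mat_vec[of _ "2 * n" "2 * n" _ "2 * n"])
    finally show ?case .
  qed
  have "traj n M x0 k $ i = c $ i + (\<Sum>j<2 * n. (N ^\<^sub>m k) $$ (i, j) * d $ j)" for k
  proof -
    have "traj n M x0 k = (M ^\<^sub>m k) *\<^sub>v (c + d)" by (simp add: traj_def u_def flip: u)
    also have "\<dots> = c + (N ^\<^sub>m k) *\<^sub>v d"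
      using M carr by (subst mult_add_distrib_mat_vec[of _ "2 * n" "2 * n"]) (auto simp: powc powd dsum)
    finally show ?thesis using i N carr by (simp add: scalar_prod_def atLeast0LessThan)
  qed
  moreover have "(\<lambda>k. c $ i + (\<Sum>j<2 * n. (N ^\<^sub>m k) $$ (i, j) * d $ j)) \<longlonglongrightarrow> c $ i + (\<Sum>j<2 * n. 0 * d $ j)"
    using i by (intro tendsto_intros lim) auto
  ultimately show "(\<lambda>k. traj n M x0 k $ i) \<longlonglongrightarrow> (if i < n then (\<Sum>j<n. x0 j) / real n else 0)"
    using i unfolding xa_def[symmetric] by (simp add: c_def)
qed

theorem proposition1:
  fixes n :: nat and E :: "(nat \<times> nat) set" and a b :: "nat \<Rightarrow> nat \<Rightarrow> real" and \<epsilon> :: real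
  assumes "n > 1"
    and "digraph_on n E"
    and "strongly_connected n E"
    and "valid_a n E a"
    and "valid_b n E b"
    and "0 < \<epsilon>"
    and "\<epsilon> < (1 - r_rem (M0_mat n a b)) ^ n / (20 + 8 * real n) ^ n"
  shows "average_consensus n (M_mat n a b \<epsilon>)"
proof -
  note n = assms(1) and \<epsilon> = assms(6,7)
  have n0: "n > 0" using n by simp
  define P where "P = (\<lambda>i j. (if i = j then 1 - (\<Sum>k<n. a i k) else 0) + a i j)"
  define S where "S = (\<lambda>i j. (if i = j then 1 - (\<Sum>k<n. b i k) else 0) + b j i)"
  have a0: "0 \<le> a i j" "(\<Sum>j<n. a i j) < 1" if "i < n" "j < n" for i j
    using assms(4) that unfolding valid_a_def by force+
  have b0: "0 \<le> b i j" "(\<Sum>j<n. b i j) < 1" if "i < n" "j < n" for i j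
    using assms(5) that unfolding valid_b_def by force+
  have P: "row_stochastic n P"
    using a0 n0 by (force simp: row_stochastic_def P_def sum.distrib intro: add_nonneg_nonneg less_imp_le)
  have S: "row_stochastic n (\<lambda>i j. S j i)"
    using b0 n0 by (force simp: row_stochastic_def S_def sum.distrib intro: add_nonneg_nonneg less_imp_le)
  have E: "E \<subseteq> {..<n} \<times> {..<n}" using assms(2) by (simp add: digraph_on_def)
  have irrP: "irreducible_fun n P"
  proof -
    \<comment> \<open>The graph of P contains the edges reversed, since a_ij belongs to the edge
      from j to i.\<close>
    have "E\<inverse> \<subseteq> {(i, j). i < n \<and> j < n \<and> 0 < P i j}"
    proof clarify
      fix j i assume e: "(j, i) \<in> E"
      then have ij: "i < n" "j < n" using E by auto
      then have "0 < a i j" using e assms(4) by (auto simp: valid_a_def)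
      then show "i < n \<and> j < n \<and> 0 < P i j" using ij a0[OF ij] by (auto simp: P_def)
    qed
    from rtrancl_mono[OF this] show ?thesis
      using assms(3) by (force simp: irreducible_fun_def strongly_connected_def rtrancl_converse)
  qed
  have irrS: "irreducible_fun n (\<lambda>i j. S j i)"
  proof -
    have "E \<subseteq> {(i, j). i < n \<and> j < n \<and> 0 < S j i}"
    proof clarify
      fix i j assume e: "(i, j) \<in> E"
      then have ij: "i < n" "j < n" using E by auto
      then have "0 < b i j" using e assms(5) by (auto simp: valid_b_def)
      then show "i < n \<and> j < n \<and> 0 < S j i" using ij b0[OF ij] by (auto simp: S_def)
    qed
    from rtrancl_mono[OF this] show ?thesis
      using assms(3) by (force simp: irreducible_fun_def strongly_connected_def)
  qed
  have L: "L_mat n a \<in> carrier_mat n n" by (simp add: L_mat_def D_mat_def A_mat_def minus_carrier_mat)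
  have PL: "1\<^sub>m n - L_mat n a = mat n n (\<lambda>(i, j). P i j)"
    by (rule eq_matI) (auto simp: L_mat_def D_mat_def A_mat_def P_def)
  have SS: "S_mat n b = mat n n (\<lambda>(i, j). S i j)"
    by (rule eq_matI) (auto simp: S_mat_def D_mat_def B_mat_def S_def)
  define r where "r = r_rem (M0_mat n a b)"
  have r_eq: "r = r_rem (four_block_mat (mat n n (\<lambda>(i, j). P i j)) (0\<^sub>m n n) (L_mat n a) (mat n n (\<lambda>(i, j). S i j)))"
    by (simp add: r_def M0_mat_def PL SS)
  obtain as bs where
    as: "char_poly (mat n n (\<lambda>(i, j). complex_of_real (P i j))) = [:-1, 1:] * (\<Prod>a\<leftarrow>as. [:-a, 1:])"
    and bs: "char_poly (mat n n (\<lambda>(i, j). complex_of_real (S i j))) = [:-1, 1:] * (\<Prod>a\<leftarrow>bs. [:-a, 1:])"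
    and len: "length as = n - 1" "length bs = n - 1"
    and le: "\<And>a. a \<in> set as \<union> set bs \<Longrightarrow> cmod a \<le> r" and r: "0 \<le> r" "r \<le> 1"
    using r_rem_block_triangular[OF n P S L] unfolding r_eq by blast
  \<comment> \<open>For r = 1 the threshold would be 0 and no positive \<epsilon> could lie below
    it.\<close>
  have r1: "r < 1"
  proof (rule ccontr)
    assume "\<not> r < 1"
    then have "r = 1" using r by simp
    then show False using \<epsilon> n0 by (simp add: r_def zero_power)
  qed
  define \<delta> where "\<delta> = 1 - r"
  have \<delta>: "0 < \<delta>" "\<delta> \<le> 1" using r r1 by (auto simp: \<delta>_def)
  \<comment> \<open>The ceiling is large enough for r^m \<le> 1/2 and, as \<delta> \<le> 1, at most
    2 / \<delta>. Hence \<open>q\<close> dominates m (3^(n-1) - 1), the bound on both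
    resolvents.\<close>
  define m where "m = nat \<lceil>1 / \<delta>\<rceil>"
  define q where "q = 2 / \<delta> * 3 ^ (n - 1)"
  have m: "1 / \<delta> \<le> real m" "real m \<le> 2 / \<delta>"
  proof -
    show "1 / \<delta> \<le> real m" unfolding m_def by linarith
    have "real m \<le> 1 / \<delta> + 1" using \<delta> unfolding m_def by (simp add: of_nat_nat)
    also have "\<dots> \<le> 2 / \<delta>" using \<delta> by (simp add: field_simps)
    finally show "real m \<le> 2 / \<delta>" .
  qed
  have rm: "r ^ m \<le> 1 / 2" using r(1) m(1) r1 unfolding \<delta>_def by (rule power_le_half)
  have mq: "real m * (3 ^ (n - 1) - 1) \<le> q"
    unfolding q_def using m(2) \<delta> by (intro mult_mono) auto
  have q6: "6 \<le> q"
  proof -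
    have "(3::real) ^ 1 \<le> 3 ^ (n - 1)" using n by (intro power_increasing) auto
    then have "2 * 3 \<le> 2 / \<delta> * 3 ^ (n - 1)" using \<delta> by (intro mult_mono) (auto simp: field_simps)
    then show ?thesis by (simp add: q_def)
  qed
  have small: "4 * \<epsilon> * q * (2 * real n * q + 1) \<le> 1"
    using small_parameter[OF n \<delta> \<epsilon>(1)] \<epsilon>(2) by (simp add: \<delta>_def q_def r_def)
  obtain w where w: "stationary n P w" using stationary_exists[OF P n0] .
  obtain v where v: "stationary n (\<lambda>i j. S j i) v" using stationary_exists[OF S n0] .
  have t: "0 < (\<Sum>i<n. w i * v i)"
    using stationary_pos[OF P irrP w] stationary_pos[OF S irrS v] n0 by (intro sum_pos) auto
  define M where "M = M_mat n a b \<epsilon>"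
  have Lij: "L_mat n a $$ (i, j) = of_bool (i = j) - P i j" if "i < n" "j < n" for i j
    using that by (auto simp: L_mat_def D_mat_def A_mat_def P_def)
  have M: "M \<in> carrier_mat (2 * n) (2 * n)"
    unfolding M_def M_mat_def PL SS mult_2
    by (intro four_block_carrier_mat minus_carrier_mat mat_carrier smult_carrier_mat one_carrier_mat)
  have M_entries: "M $$ (i, j) = P i j" "M $$ (i, n + j) = \<epsilon> * of_bool (i = j)"
    "M $$ (n + i, j) = of_bool (i = j) - P i j" "M $$ (n + i, n + j) = S i j - \<epsilon> * of_bool (i = j)"
    if "i < n" "j < n" for i j
    using that L by (auto simp: M_def M_mat_def PL SS Lij)
  have Prow: "(\<Sum>j<n. P i j) = 1" if "i < n" for i using row_stochasticD(2)[OF P that] .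
  have Scol: "(\<Sum>i<n. S i j) = 1" if "j < n" for j using row_stochasticD(2)[OF S that] .
  have range: "(\<forall>i<2 * n. Q i) \<longleftrightarrow> (\<forall>i<n. Q i) \<and> (\<forall>i<n. Q (n + i))" for Q
  proof (intro iffI conjI allI impI)
    fix i assume Q: "(\<forall>i<n. Q i) \<and> (\<forall>i<n. Q (n + i))" and i: "i < 2 * n"
    show "Q i"
    proof (cases "i < n")
      case False
      then show ?thesis using Q i by (metis add_diff_inverse_nat less_diff_conv2 mult_2 not_less)
    qed (use Q in auto)
  qed auto
  have "average_consensus n M"
  proof (rule average_consensusI[OF n0 M])
    have two: "(\<Sum>i<2 * n. f i) = (\<Sum>i<n. f i) + (\<Sum>i<n. f (n + i))" for f :: "nat \<Rightarrow> real"
      by (simp add: mult_2 sum_lessThan_add)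
    have dl: "(\<Sum>i<n. c * of_bool (i = j)) = c" "(\<Sum>i<n. of_bool (i = j)) = (1 :: real)"
      "(\<Sum>i<n. of_bool (j = i)) = (1 :: real)" if "j < n" for c :: real and j
      using that by (simp_all add: of_bool_def if_distrib cong: if_cong)
    have "\<forall>j<2 * n. (\<Sum>i<2 * n. M $$ (i, j)) = 1"
      unfolding range two by (auto simp: M_entries sum_subtractf Scol dl)
    then show "(\<Sum>i<2 * n. M $$ (i, j)) = 1" if "j < 2 * n" for j using that by blast
    have "\<forall>i<2 * n. (\<Sum>j<n. M $$ (i, j)) = (if i < n then 1 else 0)"
      unfolding range by (auto simp: M_entries Prow sum_subtractf dl)
    then show "(\<Sum>j<n. M $$ (i, j)) = (if i < n then 1 else 0)" if "i < 2 * n" for i using that by blast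
    fix z :: complex and y :: "nat \<Rightarrow> complex" and i
    assume z: "cmod z \<ge> 1" and ev: "\<And>i. i < 2 * n \<Longrightarrow> (\<Sum>j<2 * n. complex_of_real (M $$ (i, j)) * y j) = z * y i"
      and sum0: "(\<Sum>j<2 * n. y j) = 0" and i: "i < 2 * n"
    \<comment> \<open>The first block may stay y itself, since only its entries below
      \<open>n\<close> are read.\<close>
    define x where "x = y"
    define s where "s = (\<lambda>i. y (n + i))"
    have split: "(\<Sum>j<2 * n. complex_of_real (M $$ (i, j)) * y j)
        = (\<Sum>j<n. complex_of_real (M $$ (i, j)) * x j) + (\<Sum>j<n. complex_of_real (M $$ (i, n + j)) * s j)" for i
      by (simp add: mult_2 sum_lessThan_add x_def s_def)
    have delta: "(\<Sum>j<n. of_bool (i = j) * f j) = f i" if "i < n" for f :: "nat \<Rightarrow> complex" and i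
      using that by (simp add: of_bool_def if_distrib[of "\<lambda>u. u * _"] cong: if_cong)
    have ob: "complex_of_real (of_bool c) = of_bool c" for c by (simp add: of_bool_def)
    have e1: "z * x i = (\<Sum>j<n. of_real (P i j) * x j) + of_real \<epsilon> * s i" if i: "i < n" for i
    proof -
      have "z * x i = (\<Sum>j<n. of_real (P i j) * x j) + (\<Sum>j<n. of_real \<epsilon> * (of_bool (i = j) * s j))"
        using ev[of i] i unfolding split by (simp add: M_entries x_def mult.assoc ob)
      then show ?thesis by (simp only: delta[OF i] flip: sum_distrib_left)
    qed
    have e2: "z * s i = x i - (\<Sum>j<n. of_real (P i j) * x j) + (\<Sum>j<n. of_real (S i j) * s j) - of_real \<epsilon> * s i"
      if i: "i < n" for i
    proof -
      have "z * s i = (\<Sum>j<n. of_bool (i = j) * x j - of_real (P i j) * x j)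
          + (\<Sum>j<n. of_real (S i j) * s j - of_real \<epsilon> * (of_bool (i = j) * s j))"
        using ev[of "n + i"] i unfolding split by (simp add: M_entries s_def left_diff_distrib mult.assoc ob)
      then show ?thesis by (simp only: sum_subtractf delta[OF i] add_diff_eq flip: sum_distrib_left)
    qed
    have e3: "(\<Sum>i<n. x i) + (\<Sum>i<n. s i) = 0"
      using sum0 by (simp add: mult_2 sum_lessThan_add x_def s_def)
    have Q: "cmod (f i) \<le> q * B" if f: "(\<Sum>i<n. of_real (w i) * f i) = 0"
      "\<And>i. i < n \<Longrightarrow> cmod (z * f i - (\<Sum>j<n. of_real (P i j) * f j)) \<le> B" "i < n" for f B i
    proof -
      have "cmod (f i) \<le> real m * (3 ^ length as - 1) * B"
        using le by (intro sup_resolvent_bound[OF n0 P irrP w z r(1) rm _ as f]) auto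
      \<comment> \<open>B is nonnegative because it bounds a modulus at index 0.\<close>
      also have "\<dots> \<le> q * B"
        unfolding len using mq order_trans[OF norm_ge_zero f(2)[OF n0]] by (intro mult_right_mono)
      finally show ?thesis .
    qed
    obtain F where F: "lin_op F" and Fb: "\<And>f. l1_norm n (F f) \<le> real m * (3 ^ length bs - 1) * l1_norm n f"
      and Finv: "\<And>f. (\<And>i. i \<ge> n \<Longrightarrow> f i = 0) \<Longrightarrow> (\<Sum>i<n. f i) = 0 \<Longrightarrow>
        F (\<lambda>i. z * f i - mat_op n (\<lambda>i j. of_real (S i j)) f i) = f"
      using l1_resolvent[OF S irrS v z r(1) rm _ bs] le by blast
    have Fq: "l1_norm n (F f) \<le> q * l1_norm n f" for f
      using Fb[of f] mult_right_mono[OF mq seminorm_nonneg[OF seminorm_l1_norm, of n f]] unfolding len by linarith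
    have zero: "x i = 0 \<and> s i = 0" if "i < n" for i
      by (rule no_unstable_eigenvector[where P = P and S = S and w = w and v = v and x = x and s = s
            and l = z and q = q and F = F and n = n and \<epsilon> = \<epsilon>])
        (fact n0 P w v t e1 e2 e3 Q F Fq Finv z \<epsilon>(1) q6 small that)+
    have "\<forall>i<2 * n. y i = 0" unfolding range using zero by (auto simp: x_def s_def)
    then show "y i = 0" using i by blast
  qed
  then show ?thesis by (simp add: M_def)
qed

end
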